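(* Consider $\min_{\mathbf{x}\in\mathbb{R}^d}F(\mathbf{x})=f(\mathbf{x})+r(\mathbf{x})$ with $f(\mathbf{x})=\mathbb{E}_\xi[f(\mathbf{x};\xi)]$, where $r:\mathbb{R}^d\to\mathbb{R}\cup\{+\infty\}$ is proper and lower-semicontinuous (possibly non-smooth, non-convex). Assume: (i) $\mathbb{E}_\xi[\nabla f(\mathbf{x};\xi)]=\nabla f(\mathbf{x})$ and $\mathbb{E}_\xi[\|\nabla f(\mathbf{x};\xi)-\nabla f(\mathbf{x})\|^2]\le\sigma^2$ for all $\mathbf{x}$, for some $\sigma>0$; (ii) $F(\mathbf{x}_0)-F(\mathbf{x}_* )\le\Delta<\infty$ for the initial point $\mathbf{x}_0$, where $\mathbf{x}_*$ is a global minimizer of $F$; (iii) for some $L>0$, $f$ is differentiable with $\|\nabla f(\mathbf{x})-\nabla f(\mathbf{y})\|\le L\|\mathbf{x}-\mathbf{y}\|$ for all $\mathbf{x},\mathbf{y}$; (iv) with the same $L$, every $f(\cdot;\xi)$ is differentiable with $\|\nabla f(\mathbf{x};\xi)-\nabla f(\mathbf{y};\xi)\|\le L\|\mathbf{x}-\mathbf{y}\|$ for all $\mathbf{x},\mathbf{y}$. Let $\eta=\frac{c}{L}$ with $0<c<\frac13$, and assume $\mathrm{prox}_{\eta r}[\mathbf{x}]\ne\emptyset$ for every $\mathbf{x}$. Run algorithm SPGR (defined in the context) for $T\ge1$ iterations with $q=|\mathcal{S}_2|$. Then the output $\mathbf{x}_R$ satisfies $$\mathbb{E}\big[\mathrm{dist}(0,\hat\partial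 F(\mathbf{x}_R))^2\big]\le\frac{2\theta\Delta+\gamma\eta\Delta}{\eta\theta T}+\frac{(\gamma+4\theta L)\sigma^2}{2\theta L|\mathcal{S}_1|}$$ in the online setting, and $$\mathbb{E}\big[\mathrm{dist}(0,\hat\partial F(\mathbf{x}_R))^2\big]\le\frac{2\theta\Delta+\gamma\eta\Delta}{\eta\theta T}$$ in the finite-sum setting, where $\gamma=4L^2+\frac{1}{\eta^2}+\frac{2L}{\eta}$ and $\theta=\frac{1-3\eta L}{2\eta}$ are positive constants.
   Context: Settings: in the finite-sum setting $f(\mathbf{x})=\frac1n\sum_{i=1}^nf_i(\mathbf{x})$, i.e. $\xi$ is uniform on $\{1,\dots,n\}$ and $f(\cdot;i)=f_i$; the online setting is the general expectation case. For a finite batch $\mathcal{S}$ of samples, $\nabla f_{\mathcal{S}}(\mathbf{x})=\frac{1}{|\mathcal{S}|}\sum_{\xi_i\in\mathcal{S}}\nabla f(\mathbf{x};\xi_i)$. Algorithm SPGR (stochastic proximal gradient with SPIDER/SARAH), with positive integer parameters $T,q,|\mathcal{S}_1|,|\mathcal{S}_2|$ and step size $\eta$: starting from $\mathbf{x}_0$, for $t=0,\dots,T-1$: if $q$ divides $t$, then in the online setting draw a fresh batch $\mathcal{S}_1$ of $|\mathcal{S}_1|$ i.i.d. samples and set $\mathbf{g}_t=\nabla f_{\mathcal{S}_1}(\mathbf{x}_t)$, while in the finite-sum setting $\mathcal{S}_1$ is the full data set ($|\mathcal{S}_1|=n$) so $\mathbf{g}_t=\nabla f(\mathbf{x}_t)$;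 otherwise draw a fresh batch $\mathcal{S}_2$ of $|\mathcal{S}_2|$ i.i.d. samples and set $\mathbf{g}_t=\nabla f_{\mathcal{S}_2}(\mathbf{x}_t)-\nabla f_{\mathcal{S}_2}(\mathbf{x}_{t-1})+\mathbf{g}_{t-1}$. Fresh batches are independent of the past. Then choose $\mathbf{x}_{t+1}\in\mathrm{prox}_{\eta r}[\mathbf{x}_t-\eta\mathbf{g}_t]$ (the iterates being random variables). Output $\mathbf{x}_R$ with $R$ uniform on $\{1,\dots,T\}$, independent of everything else. $\|\cdot\|$ is the Euclidean norm; $\mathrm{prox}_{\eta r}[\mathbf{x}]=\arg\min_{\mathbf{y}\in\mathbb{R}^d}\frac{1}{2\eta}\|\mathbf{y}-\mathbf{x}\|^2+r(\mathbf{y})$ (set of minimizers). For $h:\mathbb{R}^d\to\mathbb{R}\cup\{+\infty\}$ and $\bar{\mathbf{x}}$ with $h(\bar{\mathbf{x}})$ finite, the Fréchet subgradient set is $\hat\partial h(\bar{\mathbf{x}})=\{\mathbf{v}\in\mathbb{R}^d:\liminf_{\mathbf{x}\to\bar{\mathbf{x}},\,\mathbf{x}\ne\bar{\mathbf{x}}}\frac{h(\mathbf{x})-h(\bar{\mathbf{x}})-\mathbf{v}^\top(\mathbf{x}-\bar{\mathbf{x}})}{\|\mathbf{x}-\bar{\mathbf{x}}\|}\ge0\}$. $\mathrm{dist}(0,S)=\inf_{\mathbf{v}\in S}\|\mathbf{v}\|$ (and $+\infty$ if $S=\emptyset$). *)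

theory Defs
  imports "HOL-Probability.Probability"
begin

subsection \<open>Variational notions\<close>

definition grad :: "('a::euclidean_space \<Rightarrow> real) \<Rightarrow> 'a \<Rightarrow> 'a" where
  "grad h x = (THE g. GDERIV h x :> g)"

lemma grad_eqI:
  assumes "GDERIV h x :> g"
  shows "grad h x = g"
  unfolding grad_def
proof (rule the_equality)
  fix g' assume "GDERIV h x :> g'"
  with assms have "(\<lambda>v. inner v g') = (\<lambda>v. inner v g)"
    unfolding gderiv_def by (rule has_derivative_unique[rotated])
  then show "g' = g"
    by (metis inner_commute vector_eq_rdot)
qed (fact assms)

lemma GDERIV_grad:
  assumes "h differentiable (at x)"
  shows "GDERIV h x :> grad h x"
proof -
  obtain h' where h': "(h has_derivative h') (at x)"
    using assms unfolding differentiable_def by blast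
  then interpret linear h'
    by (rule has_derivative_linear)
  have "h' = (\<lambda>v. inner v (adjoint h' 1))"
    using adjoint_works[OF linear_axioms, of _ 1] by (auto simp: inner_real_def)
  then have "GDERIV h x :> adjoint h' 1"
    using h' unfolding gderiv_def by simp
  then show ?thesis
    using grad_eqI by metis
qed

definition lipschitz_grad :: "real \<Rightarrow> ('a::euclidean_space \<Rightarrow> real) \<Rightarrow> bool" where
  "lipschitz_grad L h \<longleftrightarrow>
     (\<forall>x. h differentiable (at x)) \<and>
     (\<forall>x y. norm (grad h x - grad h y) \<le> L * norm (x - y))"

definition proper :: "('a \<Rightarrow> ereal) \<Rightarrow> bool" where
  "proper r \<longleftrightarrow> (\<forall>x. r x \<noteq> -\<infinity>) \<and> (\<exists>x. r x \<noteq> \<infinity>)"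

definition lower_semicont :: "('a::topological_space \<Rightarrow> ereal) \<Rightarrow> bool" where
  "lower_semicont r \<longleftrightarrow> (\<forall>x. r x \<le> Liminf (at x) r)"

definition prox :: "real \<Rightarrow> ('a::euclidean_space \<Rightarrow> ereal) \<Rightarrow> 'a \<Rightarrow> 'a set" where
  "prox \<eta> r x =
     {y. is_arg_min (\<lambda>z. ereal (1 / (2 * \<eta>) * (norm (z - x))\<^sup>2) + r z) (\<lambda>_. True) y}"

text \<open>The punctured filter \<^term>\<open>at x\<close> builds in the restriction to points different from
  \<^term>\<open>x\<close>. By convention the set is empty where \<^term>\<open>h\<close> is not finite.\<close>

definition frechet_subdiff :: "('a::euclidean_space \<Rightarrow> ereal) \<Rightarrow> 'a \<Rightarrow> 'a set" where
  "frechet_subdiff h x =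
     {v. \<bar>h x\<bar> \<noteq> \<infinity> \<and>
         0 \<le> Liminf (at x) (\<lambda>y. (h y - h x - ereal (inner v (y - x))) / ereal (norm (y - x)))}"

text \<open>Valued in \<^typ>\<open>ennreal\<close>, so that the infimum over the empty set is infinite
  (whereas \<^const>\<open>infdist\<close> would return 0).\<close>

definition dist0 :: "'a::euclidean_space set \<Rightarrow> ennreal" where
  "dist0 S = (INF v\<in>S. ennreal (norm v))"

subsection \<open>Stochastic objective\<close>

text \<open>\<^term>\<open>D\<close> is the law of the sample \<open>\<xi>\<close> and \<^term>\<open>fs s x\<close> stands for \<open>f(x; s)\<close>.\<close>

definition stochastic_objective ::
  "'s measure \<Rightarrow> ('s \<Rightarrow> 'a::euclidean_space \<Rightarrow> real) \<Rightarrow> ('a \<Rightarrow> real) \<Rightarrow> bool" where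
  "stochastic_objective D fs f \<longleftrightarrow>
     prob_space D \<and>
     (\<forall>x. integrable D (\<lambda>s. fs s x) \<and> f x = (\<integral>s. fs s x \<partial>D))"

definition unbiased_grad ::
  "'s measure \<Rightarrow> ('s \<Rightarrow> 'a::euclidean_space \<Rightarrow> real) \<Rightarrow> ('a \<Rightarrow> real) \<Rightarrow> bool" where
  "unbiased_grad D fs f \<longleftrightarrow>
     (\<forall>x. integrable D (\<lambda>s. grad (fs s) x) \<and> (\<integral>s. grad (fs s) x \<partial>D) = grad f x)"

definition bounded_grad_variance ::
  "'s measure \<Rightarrow> ('s \<Rightarrow> 'a::euclidean_space \<Rightarrow> real) \<Rightarrow> ('a \<Rightarrow> real) \<Rightarrow> real \<Rightarrow> bool" where
  "bounded_grad_variance D fs f \<sigma> \<longleftrightarrow>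
     (\<forall>x. integrable D (\<lambda>s. (norm (grad (fs s) x - grad f x))\<^sup>2) \<and>
          (\<integral>s. (norm (grad (fs s) x - grad f x))\<^sup>2 \<partial>D) \<le> \<sigma>\<^sup>2)"

definition stochastic_assms ::
  "'s measure \<Rightarrow> ('s \<Rightarrow> 'a::euclidean_space \<Rightarrow> real) \<Rightarrow> ('a \<Rightarrow> real) \<Rightarrow> real \<Rightarrow> real \<Rightarrow> bool" where
  "stochastic_assms D fs f \<sigma> L \<longleftrightarrow>
     stochastic_objective D fs f \<and> unbiased_grad D fs f \<and> bounded_grad_variance D fs f \<sigma> \<and>
     (\<forall>s\<in>space D. lipschitz_grad L (fs s))"

text \<open>In the finite-sum setting the law is uniform on \<open>{1..n}\<close>; the expectation is then the
  average of the components.\<close>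

lemma stochastic_objective_uniform:
  assumes "n \<ge> 1" and "stochastic_objective (uniform_count_measure {1..n}) fs f"
  shows "f x = (1 / real n) * (\<Sum>i=1..n. fs i x)"
proof -
  have "f x = (\<integral>i. fs i x \<partial>uniform_count_measure {1..n})"
    using assms(2) unfolding stochastic_objective_def by blast
  also have "\<dots> = (\<Sum>i=1..n. fs i x / real n)"
    unfolding uniform_count_measure_def using assms(1)
    by (subst lebesgue_integral_point_measure_finite) auto
  finally show ?thesis
    by (simp add: sum_divide_distrib)
qed

subsection \<open>The algorithm\<close>

text \<open>Independence of two random elements with possibly different value types
  (the library's \<^const>\<open>prob_space.indep_var\<close> requires a common value type).\<close>

definition indep_rv ::
  "'w measure \<Rightarrow> 'b measure \<Rightarrow> ('w \<Rightarrow> 'b) \<Rightarrow> 'c measure \<Rightarrow> ('w \<Rightarrow> 'c) \<Rightarrow> bool" where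
  "indep_rv M N Y N' Z \<longleftrightarrow>
     Y \<in> measurable M N \<and> Z \<in> measurable M N' \<and>
     prob_space.indep_set M {Y -` A \<inter> space M | A. A \<in> sets N} {Z -` A \<inter> space M | A. A \<in> sets N'}"

definition batch_grad ::
  "('s \<Rightarrow> 'a::euclidean_space \<Rightarrow> real) \<Rightarrow> nat \<Rightarrow> (nat \<Rightarrow> 's) \<Rightarrow> 'a \<Rightarrow> 'a" where
  "batch_grad fs b s x = (1 / real b) *\<^sub>R (\<Sum>j<b. grad (fs (s j)) x)"

text \<open>Iterates up to time \<^term>\<open>t\<close> together with all samples drawn before time \<^term>\<open>t\<close>.
  \<^term>\<open>\<xi> s j\<close> is the \<^term>\<open>j\<close>-th sample of the batch drawn at iteration \<^term>\<open>s\<close>, and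
  \<^term>\<open>b s\<close> is the size of that batch.\<close>

definition history ::
  "(nat \<Rightarrow> nat) \<Rightarrow> (nat \<Rightarrow> nat \<Rightarrow> 'w \<Rightarrow> 's) \<Rightarrow> (nat \<Rightarrow> 'w \<Rightarrow> 'a) \<Rightarrow> nat \<Rightarrow> 'w \<Rightarrow>
     (nat \<Rightarrow> 'a) \<times> (nat \<times> nat \<Rightarrow> 's)" where
  "history b \<xi> X t \<omega> =
     ((\<lambda>s\<in>{..t}. X s \<omega>), (\<lambda>(s, j)\<in>(SIGMA s:{..<t}. {..<b s}). \<xi> s j \<omega>))"

definition history_space ::
  "(nat \<Rightarrow> nat) \<Rightarrow> 's measure \<Rightarrow> nat \<Rightarrow>
     ((nat \<Rightarrow> 'a::euclidean_space) \<times> (nat \<times> nat \<Rightarrow> 's)) measure" where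
  "history_space b D t =
     (\<Pi>\<^sub>M s\<in>{..t}. borel) \<Otimes>\<^sub>M (\<Pi>\<^sub>M p\<in>(SIGMA s:{..<t}. {..<b s}). D)"

definition fresh_batches ::
  "'w measure \<Rightarrow> 's measure \<Rightarrow> nat \<Rightarrow> (nat \<Rightarrow> nat) \<Rightarrow> (nat \<Rightarrow> nat \<Rightarrow> 'w \<Rightarrow> 's) \<Rightarrow>
     (nat \<Rightarrow> 'w \<Rightarrow> 'a::euclidean_space) \<Rightarrow> bool" where
  "fresh_batches M D T b \<xi> X \<longleftrightarrow>
     (\<forall>t<T.
        (\<forall>j<b t. \<xi> t j \<in> measurable M D \<and> distr M D (\<xi> t j) = D) \<and>
        prob_space.indep_vars M (\<lambda>_. D) (\<xi> t) {..<b t} \<and>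
        indep_rv M (history_space b D t) (history b \<xi> X t)
          (\<Pi>\<^sub>M j\<in>{..<b t}. D) (\<lambda>\<omega>. \<lambda>j\<in>{..<b t}. \<xi> t j \<omega>))"

definition uniform_output_index ::
  "'w measure \<Rightarrow> 's measure \<Rightarrow> nat \<Rightarrow> (nat \<Rightarrow> nat) \<Rightarrow> (nat \<Rightarrow> nat \<Rightarrow> 'w \<Rightarrow> 's) \<Rightarrow>
     (nat \<Rightarrow> 'w \<Rightarrow> 'a::euclidean_space) \<Rightarrow> ('w \<Rightarrow> nat) \<Rightarrow> bool" where
  "uniform_output_index M D T b \<xi> X R \<longleftrightarrow>
     R \<in> measurable M (count_space {1..T}) \<and>
     distr M (count_space {1..T}) R = uniform_count_measure {1..T} \<and>
     indep_rv M (history_space b D T) (history b \<xi> X T) (count_space {1..T}) R"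

text \<open>\<^term>\<open>A s x\<close> is the gradient estimate formed at the iterations divisible by \<^term>\<open>q\<close> from
  the batch \<^term>\<open>s\<close> at the point \<^term>\<open>x\<close>; the other iterations use the recursive estimate.
  The subtraction \<open>t - 1\<close> is harmless because \<open>q\<close> divides 0. The choice of the
  proximal point is arbitrary (possibly randomised), subject to the iterates being random variables
  and to the independence requirements.\<close>

definition spgr_run ::
  "('s \<Rightarrow> 'a::euclidean_space \<Rightarrow> real) \<Rightarrow> ('a \<Rightarrow> ereal) \<Rightarrow> real \<Rightarrow> nat \<Rightarrow> nat \<Rightarrow> nat \<Rightarrow>
     ((nat \<Rightarrow> 's) \<Rightarrow> 'a \<Rightarrow> 'a) \<Rightarrow> 'a \<Rightarrow>
     'w measure \<Rightarrow> (nat \<Rightarrow> nat \<Rightarrow> 'w \<Rightarrow> 's) \<Rightarrow> (nat \<Rightarrow> 'w \<Rightarrow> 'a) \<Rightarrow> (nat \<Rightarrow> 'w \<Rightarrow> 'a) \<Rightarrow> bool" where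
  "spgr_run fs r \<eta> T q b2 A x0 M \<xi> G X \<longleftrightarrow>
     (\<forall>t\<le>T. X t \<in> borel_measurable M) \<and>
     (\<forall>\<omega>\<in>space M. X 0 \<omega> = x0 \<and>
        (\<forall>t<T.
           G t \<omega> =
             (if q dvd t then A (\<lambda>j. \<xi> t j \<omega>) (X t \<omega>)
              else batch_grad fs b2 (\<lambda>j. \<xi> t j \<omega>) (X t \<omega>)
                   - batch_grad fs b2 (\<lambda>j. \<xi> t j \<omega>) (X (t - 1) \<omega>) + G (t - 1) \<omega>) \<and>
           X (Suc t) \<omega> \<in> prox \<eta> r (X t \<omega> - \<eta> *\<^sub>R G t \<omega>)))"

definition spgr_online ::
  "'s measure \<Rightarrow> ('s \<Rightarrow> 'a::euclidean_space \<Rightarrow> real) \<Rightarrow> ('a \<Rightarrow> ereal) \<Rightarrow>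
     real \<Rightarrow> nat \<Rightarrow> nat \<Rightarrow> nat \<Rightarrow> nat \<Rightarrow> 'a \<Rightarrow>
     'w measure \<Rightarrow> (nat \<Rightarrow> nat \<Rightarrow> 'w \<Rightarrow> 's) \<Rightarrow> (nat \<Rightarrow> 'w \<Rightarrow> 'a) \<Rightarrow> (nat \<Rightarrow> 'w \<Rightarrow> 'a) \<Rightarrow> ('w \<Rightarrow> nat) \<Rightarrow> bool" where
  "spgr_online D fs r \<eta> T q b1 b2 x0 M \<xi> G X R \<longleftrightarrow>
     (let b = (\<lambda>t. if q dvd t then b1 else b2) in
        prob_space M \<and>
        spgr_run fs r \<eta> T q b2 (batch_grad fs b1) x0 M \<xi> G X \<and>
        fresh_batches M D T b \<xi> X \<and>
        uniform_output_index M D T b \<xi> X R)"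

text \<open>Here the full gradient is used at the iterations divisible by \<^term>\<open>q\<close>, so nothing is
  sampled there (batch size 0).\<close>

definition spgr_finite_sum ::
  "nat \<Rightarrow> (nat \<Rightarrow> 'a::euclidean_space \<Rightarrow> real) \<Rightarrow> ('a \<Rightarrow> real) \<Rightarrow> ('a \<Rightarrow> ereal) \<Rightarrow>
     real \<Rightarrow> nat \<Rightarrow> nat \<Rightarrow> nat \<Rightarrow> 'a \<Rightarrow>
     'w measure \<Rightarrow> (nat \<Rightarrow> nat \<Rightarrow> 'w \<Rightarrow> nat) \<Rightarrow> (nat \<Rightarrow> 'w \<Rightarrow> 'a) \<Rightarrow> (nat \<Rightarrow> 'w \<Rightarrow> 'a) \<Rightarrow> ('w \<Rightarrow> nat) \<Rightarrow> bool" where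
  "spgr_finite_sum n fs f r \<eta> T q b2 x0 M \<xi> G X R \<longleftrightarrow>
     (let b = (\<lambda>t. if q dvd t then 0 else b2); D = uniform_count_measure {1..n} in
        prob_space M \<and>
        spgr_run fs r \<eta> T q b2 (\<lambda>_. grad f) x0 M \<xi> G X \<and>
        fresh_batches M D T b \<xi> X \<and>
        uniform_output_index M D T b \<xi> X R)"

end

theory Submission
  imports Defs
begin

text \<open>
  Write \<open>d\<^sub>t = x\<^sub>t\<^sub>+\<^sub>1 - x\<^sub>t\<close>, \<open>e\<^sub>t = g\<^sub>t - \<nabla>f(x\<^sub>t)\<close> and let \<open>v\<^sub>t\<close> be the Frechet subgradient of \<open>F\<close> at \<open>x\<^sub>t\<^sub>+\<^sub>1\<close>
  given by the optimality of the proximal step. Optimality and smoothness give the descent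
  \<open>F(x\<^sub>t\<^sub>+\<^sub>1) + (1 - 2\<eta>L)/(2\<eta>) |d\<^sub>t|\<^sup>2 \<le> F(x\<^sub>t) + |e\<^sub>t|\<^sup>2/(2L)\<close>, and expanding \<open>|v\<^sub>t|\<^sup>2\<close>
  while bounding its cross term \<open>\<langle>e\<^sub>t, d\<^sub>t\<rangle>\<close> by the decrease of \<open>F\<close> gives
  \<open>|v\<^sub>t|\<^sup>2 \<le> (2L\<^sup>2 + 1/\<eta>\<^sup>2 + 2L/\<eta>) |d\<^sub>t|\<^sup>2 + 2|e\<^sub>t|\<^sup>2 + (2/\<eta>)(F(x\<^sub>t) - F(x\<^sub>t\<^sub>+\<^sub>1))\<close>.
  Conditionally on the past, the recursive estimator adds variance at most
  \<open>(L\<^sup>2/q) |d\<^sub>t\<^sub>-\<^sub>1|\<^sup>2\<close>, and an epoch has length \<open>q\<close>, so the expected sum of \<open>|e\<^sub>t|\<^sup>2\<close> is at most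
  \<open>T S + L\<^sup>2 E \<Sum>|d\<^sub>t|\<^sup>2\<close>, where \<open>S\<close> bounds the variance at the start of an epoch. The three estimates
  combine linearly; since \<open>R\<close> is independent of the run, \<open>E |v\<^sub>R\<^sub>-\<^sub>1|\<^sup>2\<close> is the average over \<open>t\<close>.
\<close>

subsection \<open>The proximal step\<close>

text \<open>Subtracting the quadratic model from \<open>h\<close> along the segment from
  \<open>x\<close> to \<open>y\<close> leaves \<open>\<phi>\<close>, whose derivative is nonpositive
  for \<open>t \<ge> 0\<close> by Cauchy-Schwarz and the Lipschitz bound; the claim is
  \<open>\<phi> 1 \<le> \<phi> 0\<close>.\<close>

lemma lipschitz_grad_upper:
  fixes h :: "'a::euclidean_space \<Rightarrow> real"
  assumes "lipschitz_grad L h"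
  shows "h y \<le> h x + inner (grad h x) (y - x) + L / 2 * (norm (y - x))\<^sup>2"
proof -
  define d where "d = y - x"
  define \<phi> where "\<phi> t = h (x + t *\<^sub>R d) - (t * inner (grad h x) d + L / 2 * t\<^sup>2 * (norm d)\<^sup>2)" for t :: real
  define \<phi>' where "\<phi>' t = inner d (grad h (x + t *\<^sub>R d)) - (inner (grad h x) d + L * t * (norm d)\<^sup>2)" for t :: real
  have deriv: "(\<phi> has_real_derivative \<phi>' t) (at t)" for t
  proof -
    have "(h has_derivative (\<lambda>v. inner v (grad h (x + t *\<^sub>R d)))) (at (x + t *\<^sub>R d))"
      using assms GDERIV_grad unfolding lipschitz_grad_def gderiv_def by blast
    moreover have "((\<lambda>t. x + t *\<^sub>R d) has_derivative (\<lambda>u. u *\<^sub>R d)) (at t)"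
      by (auto intro!: derivative_eq_intros)
    ultimately have "((\<lambda>t. h (x + t *\<^sub>R d)) has_derivative (\<lambda>u. inner (u *\<^sub>R d) (grad h (x + t *\<^sub>R d)))) (at t)"
      by (rule has_derivative_compose[rotated])
    moreover have "(\<lambda>u. inner (u *\<^sub>R d) (grad h (x + t *\<^sub>R d))) = (*) (inner d (grad h (x + t *\<^sub>R d)))"
      by (auto simp: mult.commute)
    ultimately have "((\<lambda>t. h (x + t *\<^sub>R d)) has_real_derivative inner d (grad h (x + t *\<^sub>R d))) (at t)"
      by (simp only: has_field_derivative_def)
    moreover have "((\<lambda>t. t * inner (grad h x) d + L / 2 * t\<^sup>2 * (norm d)\<^sup>2) has_real_derivative
        inner (grad h x) d + L * t * (norm d)\<^sup>2) (at t)"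
      by (auto intro!: derivative_eq_intros)
    ultimately show ?thesis
      unfolding \<phi>_def \<phi>'_def by (rule DERIV_diff)
  qed
  have nonpos: "\<phi>' t \<le> 0" if "0 \<le> t" for t
  proof -
    have "inner d (grad h (x + t *\<^sub>R d)) - inner (grad h x) d = inner d (grad h (x + t *\<^sub>R d) - grad h x)"
      by (simp add: inner_diff_right inner_commute)
    also have "\<dots> \<le> norm d * norm (grad h (x + t *\<^sub>R d) - grad h x)"
      by (rule norm_cauchy_schwarz)
    also have "\<dots> \<le> norm d * (L * norm (t *\<^sub>R d))"
      using assms unfolding lipschitz_grad_def
      by (metis add_diff_cancel_left' mult_left_mono norm_ge_zero)
    finally show ?thesis
      using that by (simp add: \<phi>'_def power2_eq_square algebra_simps)
  qed
  have "\<phi> 1 \<le> \<phi> 0"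
    by (rule DERIV_nonpos_imp_nonincreasing[OF zero_le_one]) (use deriv nonpos in blast)
  then show ?thesis
    by (simp add: \<phi>_def d_def)
qed

lemma lipschitz_grad_lower:
  fixes h :: "'a::euclidean_space \<Rightarrow> real"
  assumes "lipschitz_grad L h"
  shows "h x + inner (grad h x) (y - x) - L / 2 * (norm (y - x))\<^sup>2 \<le> h y"
proof -
  have "GDERIV (\<lambda>z. - h z) x :> - grad h x" for x
    using assms GDERIV_grad unfolding lipschitz_grad_def by (blast intro: GDERIV_minus)
  then have g: "grad (\<lambda>z. - h z) x = - grad h x" for x
    by (rule grad_eqI)
  have "lipschitz_grad L (\<lambda>z. - h z)"
    using assms unfolding lipschitz_grad_def g by (auto simp: norm_minus_commute)
  from lipschitz_grad_upper[OF this, of y x] show ?thesis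
    by (simp add: g)
qed

lemma continuous_on_grad:
  assumes "lipschitz_grad L h"
  shows "continuous_on UNIV (grad h)"
proof -
  \<comment> \<open>\<open>L\<close> carries no sign here, but the Lipschitz inequality itself
    forces this product to be nonnegative, so \<open>\<bar>L\<bar>\<close> can serve as the
    constant.\<close>
  have "0 \<le> L * norm (x - y)" for x y :: 'a
    using assms norm_ge_zero order_trans unfolding lipschitz_grad_def by blast
  then have "dist (grad h x) (grad h y) \<le> \<bar>L\<bar> * dist x y" for x y
    using assms unfolding lipschitz_grad_def dist_norm
    by (metis abs_mult abs_norm_cancel abs_of_nonneg)
  then have "\<bar>L\<bar>-lipschitz_on UNIV (grad h)"
    by (intro lipschitz_onI) auto
  then show ?thesis
    by (rule lipschitz_on_continuous_on)
qed

lemma prox_le: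
  assumes "y \<in> prox \<eta> r z"
  shows "ereal (1 / (2 * \<eta>) * (norm (y - z))\<^sup>2) + r y \<le> ereal (1 / (2 * \<eta>) * (norm (u - z))\<^sup>2) + r u"
  using assms unfolding prox_def is_arg_min_def by (auto simp: not_less)

lemma prox_finite:
  assumes "proper r" "y \<in> prox \<eta> r z"
  shows "\<bar>r y\<bar> \<noteq> \<infinity>"
proof -
  obtain u where "r u \<noteq> \<infinity>"
    using assms(1) unfolding proper_def by blast
  with prox_le[OF assms(2), of u] assms(1) show ?thesis
    unfolding proper_def by (cases "r y"; cases "r u") auto
qed

text \<open>Minimality of \<open>y\<close>, with the squared distance from \<open>u\<close> to
  \<open>z\<close> expanded around \<open>y\<close>. It exhibits
  \<open>(1 / \<eta>) *\<^sub>R (z - y)\<close> as a proximal subgradient of \<open>r\<close> at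
  \<open>y\<close>; the Frechet subgradient and the descent both start from this form.\<close>

lemma prox_real_le:
  assumes "0 < \<eta>" "\<bar>r u\<bar> \<noteq> \<infinity>" "\<bar>r y\<bar> \<noteq> \<infinity>" "y \<in> prox \<eta> r z"
  shows "real_of_ereal (r y) - inner ((1 / \<eta>) *\<^sub>R (z - y)) (y - u) \<le> real_of_ereal (r u) + 1 / (2 * \<eta>) * (norm (u - y))\<^sup>2"
proof -
  have "1 / (2 * \<eta>) * (norm (y - z))\<^sup>2 + real_of_ereal (r y) \<le> 1 / (2 * \<eta>) * (norm (u - z))\<^sup>2 + real_of_ereal (r u)"
    using prox_le[OF assms(4), of u] assms(2,3) by (cases "r y"; cases "r u") auto
  moreover have "1 / (2 * \<eta>) * (norm (u - z))\<^sup>2 =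
      1 / (2 * \<eta>) * (norm (u - y))\<^sup>2 + 1 / (2 * \<eta>) * (norm (y - z))\<^sup>2 + inner ((1 / \<eta>) *\<^sub>R (z - y)) (y - u)"
  proof -
    have "(norm (u - z))\<^sup>2 = (norm (u - y))\<^sup>2 + (norm (y - z))\<^sup>2 + 2 * inner (z - y) (y - u)"
      by (simp add: power2_norm_eq_inner inner_diff_left inner_diff_right inner_commute)
    then show ?thesis
      by (simp add: distrib_left)
  qed
  ultimately show ?thesis
    by linarith
qed

text \<open>The quadratic minorants of \<open>f\<close> (from smoothness) and of \<open>r\<close>
  (from the proximal step) add up to one of the sum, with linear part \<open>?v\<close>. The
  difference quotient in \<open>frechet_subdiff\<close> is then at least
  \<open>K * norm (u - y)\<close>, which tends to 0.\<close>

lemma prox_subgradient: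
  fixes f :: "'a::euclidean_space \<Rightarrow> real"
  assumes "proper r" "0 < \<eta>" "lipschitz_grad L f" "y \<in> prox \<eta> r z"
  shows "grad f y + (1 / \<eta>) *\<^sub>R (z - y) \<in> frechet_subdiff (\<lambda>x. ereal (f x) + r x) y"
proof -
  let ?F = "\<lambda>x. ereal (f x) + r x" and ?v = "grad f y + (1 / \<eta>) *\<^sub>R (z - y)"
  \<comment> \<open>Curvature of the combined minorant: \<open>- L / 2\<close> from \<open>f\<close>
    and \<open>- 1 / (2 * \<eta>)\<close> from \<open>r\<close>.\<close>
  define K where "K = - (L / 2 + 1 / (2 * \<eta>))"
  have fin: "\<bar>r y\<bar> \<noteq> \<infinity>"
    using prox_finite assms(1,4) .
  have le: "ereal (K * norm (u - y)) \<le> (?F u - ?F y - ereal (inner ?v (u - y))) / ereal (norm (u - y))"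
    if "u \<noteq> y" for u
  proof (cases "r u")
    case (real ru)
    have "real_of_ereal (r y) - inner ((1 / \<eta>) *\<^sub>R (z - y)) (y - u) \<le> ru + 1 / (2 * \<eta>) * (norm (u - y))\<^sup>2"
      using prox_real_le[OF assms(2) _ fin assms(4), of u] real by auto
    moreover have "inner ((1 / \<eta>) *\<^sub>R (z - y)) (y - u) = - inner ((1 / \<eta>) *\<^sub>R (z - y)) (u - y)"
      by (metis inner_minus_right minus_diff_eq)
    moreover note lipschitz_grad_lower[OF assms(3), of y u]
    ultimately have "K * (norm (u - y))\<^sup>2 \<le> f u + ru - (f y + real_of_ereal (r y)) - inner ?v (u - y)"
      by (simp add: K_def inner_add_left algebra_simps)
    then have "K * norm (u - y) \<le> (f u + ru - (f y + real_of_ereal (r y)) - inner ?v (u - y)) / norm (u - y)"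
      using that by (simp add: pos_le_divide_eq power2_eq_square mult_ac)
    then show ?thesis
      using real fin that by (cases "r y") auto
  next
    \<comment> \<open>The numerator is infinite and the denominator positive, so the quotient is
      infinite.\<close>
    case PInf
    then show ?thesis
      using that fin by (cases "r y") auto
  qed (use assms(1) in \<open>simp add: proper_def\<close>)
  have "((\<lambda>u. ereal (K * norm (u - y))) \<longlongrightarrow> ereal (K * norm (y - y))) (at y)"
    by (intro tendsto_intros)
  then have "Liminf (at y) (\<lambda>u. ereal (K * norm (u - y))) = 0"
    by (simp add: lim_imp_Liminf zero_ereal_def)
  moreover have "Liminf (at y) (\<lambda>u. ereal (K * norm (u - y))) \<le>
     Liminf (at y) (\<lambda>u. (?F u - ?F y - ereal (inner ?v (u - y))) / ereal (norm (u - y)))"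
    by (rule Liminf_mono) (use le in \<open>auto simp: eventually_at_filter\<close>)
  ultimately show ?thesis
    unfolding frechet_subdiff_def using fin by (cases "r y") auto
qed

text \<open>Both bounds come from \<open>key\<close>, which is the proximal inequality at
  \<open>u = x\<close> plus smoothness of \<open>f\<close>. The first removes the term
  \<open>inner e d\<close> by Young's inequality; the second reads \<open>key\<close> as an upper
  bound on that term.\<close>

lemma prox_descent:
  fixes f :: "'a::euclidean_space \<Rightarrow> real" and r :: "'a \<Rightarrow> ereal"
  defines "\<Phi> \<equiv> \<lambda>x. f x + real_of_ereal (r x)"
  assumes "0 < \<eta>" "0 < L" "\<eta> * L < 1" "lipschitz_grad L f"
    and "\<bar>r x\<bar> \<noteq> \<infinity>" "\<bar>r y\<bar> \<noteq> \<infinity>" "y \<in> prox \<eta> r (x - \<eta> *\<^sub>R g)"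
  shows "\<Phi> y + (1 - 2 * \<eta> * L) / (2 * \<eta>) * (norm (y - x))\<^sup>2 \<le> \<Phi> x + (norm (g - grad f x))\<^sup>2 / (2 * L)"
    and "(norm (grad f y + (1 / \<eta>) *\<^sub>R (x - \<eta> *\<^sub>R g - y)))\<^sup>2 \<le>
           (2 * L\<^sup>2 + 1 / \<eta>\<^sup>2 + 2 * L / \<eta>) * (norm (y - x))\<^sup>2 + 2 * (norm (g - grad f x))\<^sup>2 + 2 / \<eta> * (\<Phi> x - \<Phi> y)"
proof -
  define d e where "d = y - x" and "e = g - grad f x"
  define \<delta> where "\<delta> = grad f y - grad f x"
  have "real_of_ereal (r y) - inner ((1 / \<eta>) *\<^sub>R (x - \<eta> *\<^sub>R g - y)) (y - x) \<le> real_of_ereal (r x) + 1 / (2 * \<eta>) * (norm (x - y))\<^sup>2"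
    using assms by (intro prox_real_le) auto
  moreover have "(1 / \<eta>) *\<^sub>R (x - \<eta> *\<^sub>R g - y) = - (1 / \<eta>) *\<^sub>R d - g"
    using \<open>0 < \<eta>\<close> by (simp add: d_def algebra_simps)
  moreover have "inner (- (1 / \<eta>) *\<^sub>R d - g) d = - 1 / \<eta> * (norm d)\<^sup>2 - inner g d"
    by (simp add: power2_norm_eq_inner inner_diff_left)
  moreover have "1 / \<eta> * (norm d)\<^sup>2 = 2 * (1 / (2 * \<eta>) * (norm d)\<^sup>2)"
    by simp
  ultimately have "real_of_ereal (r y) + inner g d + 1 / (2 * \<eta>) * (norm d)\<^sup>2 \<le> real_of_ereal (r x)"
    by (simp add: d_def norm_minus_commute)
  moreover have "f y \<le> f x + inner (grad f x) d + L / 2 * (norm d)\<^sup>2"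
    unfolding d_def by (rule lipschitz_grad_upper) fact
  ultimately have key: "\<Phi> y + inner e d + (1 / (2 * \<eta>) - L / 2) * (norm d)\<^sup>2 \<le> \<Phi> x"
    by (simp add: \<Phi>_def e_def inner_diff_left algebra_simps)
  \<comment> \<open>Young's inequality with weight \<open>L\<close>. The step term has lost
    \<open>L / 2\<close> to smoothness, loses \<open>L / 2\<close> here, and will lose
    \<open>L / 2\<close> once more when the accumulated error, of order \<open>L\<^sup>2\<close>
    times the squared steps, is weighted by \<open>1 / (2 * L)\<close>. This is the origin of
    \<open>1 - 3 * \<eta> * L\<close>.\<close>
  have "0 \<le> (norm (e + L *\<^sub>R d))\<^sup>2 / (2 * L)"
    using \<open>0 < L\<close> by simp
  also have "(norm (e + L *\<^sub>R d))\<^sup>2 = (norm e)\<^sup>2 + 2 * L * inner e d + L\<^sup>2 * (norm d)\<^sup>2"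
    unfolding power2_norm_eq_inner
    by (simp add: inner_add_left inner_add_right inner_commute power2_eq_square algebra_simps)
  also have "\<dots> / (2 * L) = (norm e)\<^sup>2 / (2 * L) + inner e d + L / 2 * (norm d)\<^sup>2"
    using \<open>0 < L\<close> by (simp add: field_simps power2_eq_square)
  finally have "- inner e d \<le> (norm e)\<^sup>2 / (2 * L) + L / 2 * (norm d)\<^sup>2"
    by simp
  moreover have "(1 - 2 * \<eta> * L) / (2 * \<eta>) = (1 / (2 * \<eta>) - L / 2) - L / 2"
    using \<open>0 < \<eta>\<close> by (simp add: field_simps)
  ultimately show "\<Phi> y + (1 - 2 * \<eta> * L) / (2 * \<eta>) * (norm (y - x))\<^sup>2 \<le> \<Phi> x + (norm (g - grad f x))\<^sup>2 / (2 * L)"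
    using key unfolding d_def[symmetric] e_def[symmetric] by (simp add: left_diff_distrib)
  have \<delta>: "norm \<delta> \<le> L * norm d"
    using assms(5) unfolding lipschitz_grad_def \<delta>_def d_def by blast
  have eq: "grad f y + (1 / \<eta>) *\<^sub>R (x - \<eta> *\<^sub>R g - y) = (\<delta> - e) - (1 / \<eta>) *\<^sub>R d"
    using \<open>0 < \<eta>\<close> by (simp add: d_def e_def \<delta>_def algebra_simps)
  have "(norm ((\<delta> - e) - (1 / \<eta>) *\<^sub>R d))\<^sup>2 = (norm (\<delta> - e))\<^sup>2 + 1 / \<eta>\<^sup>2 * (norm d)\<^sup>2 - 2 / \<eta> * inner \<delta> d + 2 / \<eta> * inner e d"
    unfolding power2_norm_eq_inner
    by (simp add: inner_diff_left inner_diff_right inner_commute power2_eq_square algebra_simps)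
  moreover have "(norm (\<delta> - e))\<^sup>2 \<le> 2 * L\<^sup>2 * (norm d)\<^sup>2 + 2 * (norm e)\<^sup>2"
  proof -
    have "(norm (\<delta> - e))\<^sup>2 \<le> 2 * (norm \<delta>)\<^sup>2 + 2 * (norm e)\<^sup>2"
      using zero_le_power2[of "norm (\<delta> + e)"] unfolding power2_norm_eq_inner
      by (simp add: inner_diff_left inner_diff_right inner_add_left inner_add_right inner_commute)
    moreover have "(norm \<delta>)\<^sup>2 \<le> (L * norm d)\<^sup>2"
      using \<delta> by (rule power_mono) simp
    ultimately show ?thesis
      by (simp add: power_mult_distrib)
  qed
  moreover have "- (2 / \<eta> * inner \<delta> d) \<le> 2 * L / \<eta> * (norm d)\<^sup>2"
  proof -
    have "- inner \<delta> d \<le> norm \<delta> * norm d"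
      using Cauchy_Schwarz_ineq2[of \<delta> d] by linarith
    also have "\<dots> \<le> L * norm d * norm d"
      using \<delta> by (rule mult_right_mono) simp
    finally have "2 / \<eta> * (- inner \<delta> d) \<le> 2 / \<eta> * (L * norm d * norm d)"
      using \<open>0 < \<eta>\<close> by (intro mult_left_mono) auto
    then show ?thesis
      by (simp add: power2_eq_square mult_ac)
  qed
  moreover have "2 / \<eta> * inner e d \<le> 2 / \<eta> * (\<Phi> x - \<Phi> y)"
  proof -
    have "1 / (2 * \<eta>) - L / 2 = (1 - \<eta> * L) / (2 * \<eta>)"
      using \<open>0 < \<eta>\<close> by (simp add: field_simps)
    then have "0 \<le> (1 / (2 * \<eta>) - L / 2) * (norm d)\<^sup>2"
      using \<open>0 < \<eta>\<close> \<open>\<eta> * L < 1\<close> by simp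
    then have "inner e d \<le> \<Phi> x - \<Phi> y"
      using key by linarith
    then show ?thesis
      using \<open>0 < \<eta>\<close> by (intro mult_left_mono) auto
  qed
  ultimately show "(norm (grad f y + (1 / \<eta>) *\<^sub>R (x - \<eta> *\<^sub>R g - y)))\<^sup>2 \<le>
           (2 * L\<^sup>2 + 1 / \<eta>\<^sup>2 + 2 * L / \<eta>) * (norm (y - x))\<^sup>2 + 2 * (norm (g - grad f x))\<^sup>2 + 2 / \<eta> * (\<Phi> x - \<Phi> y)"
    unfolding eq d_def[symmetric] e_def[symmetric] by (simp add: distrib_right)
qed

lemma dist0_power2_le:
  assumes "v \<in> A"
  shows "(dist0 A)\<^sup>2 \<le> ennreal ((norm v)\<^sup>2)"
proof -
  have "dist0 A \<le> ennreal (norm v)"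
    unfolding dist0_def using assms by (rule INF_lower)
  then have "(dist0 A)\<^sup>2 \<le> (ennreal (norm v))\<^sup>2"
    by (rule power_mono) simp
  then show ?thesis
    by (simp add: ennreal_power)
qed

subsection \<open>Second moments of batch averages\<close>

text \<open>Measurability in the sample is known only at fixed points, while the algorithm evaluates
  gradients at random ones. Approximating the point by simple functions reduces to finitely many
  fixed points, and continuity yields the limit.\<close>

lemma borel_measurable_Caratheodory:
  fixes g :: "'s \<Rightarrow> 'a::{metric_space, second_countable_topology} \<Rightarrow> 'b::metric_space"
  assumes g: "\<And>x. (\<lambda>s. g s x) \<in> borel_measurable N"
    and cont: "\<And>s. s \<in> space N \<Longrightarrow> continuous_on UNIV (g s)"
  shows "(\<lambda>(s, x). g s x) \<in> borel_measurable (N \<Otimes>\<^sub>M borel)"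
proof -
  have "(\<lambda>x. x) \<in> borel_measurable (borel :: 'a measure)"
    by simp
  from borel_measurable_implies_sequence_metric[OF this, of undefined]
  obtain F :: "nat \<Rightarrow> 'a \<Rightarrow> 'a" where F: "\<And>i. simple_function borel (F i)" "\<And>x. (\<lambda>i. F i x) \<longlonglongrightarrow> x"
    by (auto simp: space_borel)
  have "(\<lambda>p. g (fst p) (F i (snd p))) \<in> borel_measurable (N \<Otimes>\<^sub>M borel)" for i
  proof (rule measurable_compose_countable'[where f = "\<lambda>a p. g (fst p) a" and g = "\<lambda>p. F i (snd p)" and I = "range (F i)"])
    show "(\<lambda>p. g (fst p) a) \<in> borel_measurable (N \<Otimes>\<^sub>M borel)" for a
      using g by measurable
    have "F i \<in> borel \<rightarrow>\<^sub>M count_space (range (F i))"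
      using F(1)[of i] by (auto simp: simple_function_def measurable_count_space_eq2 space_borel)
    then show "(\<lambda>p. F i (snd p)) \<in> N \<Otimes>\<^sub>M borel \<rightarrow>\<^sub>M count_space (range (F i))"
      by measurable
    show "countable (range (F i))"
      using F(1)[of i] by (simp add: simple_function_def space_borel countable_finite)
  qed
  moreover have "(\<lambda>i. g (fst p) (F i (snd p))) \<longlonglongrightarrow> (case p of (s, x) \<Rightarrow> g s x)"
    if "p \<in> space (N \<Otimes>\<^sub>M borel)" for p
    using that cont[of "fst p"] F(2)[of "snd p"]
    by (auto simp: space_pair_measure split_beta continuous_on_eq_continuous_at intro: isCont_tendsto_compose)
  ultimately show ?thesis
    by (rule borel_measurable_LIMSEQ_metric)
qed

context prob_space
begin

text \<open>The cross term \<open>2 * inner a (Z s)\<close> has expectation 0.\<close>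

lemma nn_integral_norm_add:
  fixes Z :: "'a \<Rightarrow> 'b::euclidean_space"
  assumes "integrable M Z" "expectation Z = 0" "integrable M (\<lambda>s. (norm (Z s))\<^sup>2)"
  shows "(\<integral>\<^sup>+s. ennreal ((norm (a + Z s))\<^sup>2) \<partial>M) = ennreal ((norm a)\<^sup>2 + expectation (\<lambda>s. (norm (Z s))\<^sup>2))"
proof -
  have eq: "(norm (a + Z s))\<^sup>2 = (norm a)\<^sup>2 + 2 * inner a (Z s) + (norm (Z s))\<^sup>2" for s
    unfolding power2_norm_eq_inner by (simp add: inner_add_left inner_add_right inner_commute)
  have "integrable M (\<lambda>s. (norm (a + Z s))\<^sup>2)"
    unfolding eq using assms by simp
  then have "(\<integral>\<^sup>+s. ennreal ((norm (a + Z s))\<^sup>2) \<partial>M) = ennreal (expectation (\<lambda>s. (norm (a + Z s))\<^sup>2))"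
    by (intro nn_integral_eq_integral) auto
  also have "expectation (\<lambda>s. (norm (a + Z s))\<^sup>2) = (norm a)\<^sup>2 + expectation (\<lambda>s. (norm (Z s))\<^sup>2)"
    unfolding eq using assms by (simp add: prob_space)
  finally show ?thesis .
qed

text \<open>Centring can only decrease the second moment, and the uniform bound supplies
  integrability. The intended \<open>Y\<close> is a difference of sample gradients at two points,
  bounded by the Lipschitz condition.\<close>

lemma centered_second_moment_le:
  fixes Y :: "'a \<Rightarrow> 'b::euclidean_space"
  assumes "Y \<in> borel_measurable M" "\<And>s. s \<in> space M \<Longrightarrow> norm (Y s) \<le> B"
  shows "integrable M (\<lambda>s. (norm (Y s - expectation Y))\<^sup>2)"
    and "expectation (\<lambda>s. (norm (Y s - expectation Y))\<^sup>2) \<le> B\<^sup>2"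
proof -
  have Y: "integrable M Y"
    using assms by (intro integrable_const_bound[of _ B]) auto
  have B2: "(norm (Y s))\<^sup>2 \<le> B\<^sup>2" if "s \<in> space M" for s
    using assms(2)[OF that] by (intro power_mono) auto
  have Y2: "integrable M (\<lambda>s. (norm (Y s))\<^sup>2)"
    using assms B2 by (intro integrable_const_bound[of _ "B\<^sup>2"]) auto
  have eq: "(norm (Y s - expectation Y))\<^sup>2 = (norm (Y s))\<^sup>2 - 2 * inner (Y s) (expectation Y) + (norm (expectation Y))\<^sup>2" for s
    unfolding power2_norm_eq_inner by (simp add: inner_diff_left inner_diff_right inner_commute)
  show "integrable M (\<lambda>s. (norm (Y s - expectation Y))\<^sup>2)"
    unfolding eq using Y Y2 by simp
  have "expectation (\<lambda>s. (norm (Y s - expectation Y))\<^sup>2) = expectation (\<lambda>s. (norm (Y s))\<^sup>2) - (norm (expectation Y))\<^sup>2"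
    unfolding eq using Y Y2 by (simp add: prob_space power2_norm_eq_inner)
  also have "\<dots> \<le> expectation (\<lambda>s. (norm (Y s))\<^sup>2)"
    by simp
  also have "\<dots> \<le> expectation (\<lambda>s. B\<^sup>2)"
    using B2 Y2 by (intro integral_mono) auto
  finally show "expectation (\<lambda>s. (norm (Y s - expectation Y))\<^sup>2) \<le> B\<^sup>2"
    by (simp add: prob_space)
qed

text \<open>One coordinate is integrated out at a time. With the others frozen,
  \<open>nn_integral_norm_add\<close> applies with shift \<open>a\<close> plus the remaining sum, so
  each coordinate contributes its own variance and no cross terms.\<close>

lemma second_moment_iid_sum:
  fixes Z :: "'a \<Rightarrow> 'b::euclidean_space"
  assumes "finite I"
    and Z: "integrable M Z" "expectation Z = 0" "integrable M (\<lambda>s. (norm (Z s))\<^sup>2)"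
  shows "(\<integral>\<^sup>+s. ennreal ((norm (a + (\<Sum>i\<in>I. Z (s i))))\<^sup>2) \<partial>Pi\<^sub>M I (\<lambda>_. M)) =
           ennreal ((norm a)\<^sup>2 + card I * expectation (\<lambda>s. (norm (Z s))\<^sup>2))"
  using \<open>finite I\<close>
proof induction
  case empty
  then show ?case
    by (simp add: prob_space.emeasure_space_1[OF prob_space_PiM] prob_space_axioms)
next
  case (insert i I)
  interpret product_sigma_finite "\<lambda>_. M" ..
  interpret P: prob_space "Pi\<^sub>M I (\<lambda>_. M)"
    by (intro prob_space_PiM prob_space_axioms)
  let ?K = "expectation (\<lambda>s. (norm (Z s))\<^sup>2)"
  have [measurable]: "Z \<in> borel_measurable M"
    using Z(1) by auto
  have "(\<integral>\<^sup>+s. ennreal ((norm (a + (\<Sum>i\<in>insert i I. Z (s i))))\<^sup>2) \<partial>Pi\<^sub>M (insert i I) (\<lambda>_. M)) =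
      (\<integral>\<^sup>+s. \<integral>\<^sup>+u. ennreal ((norm (a + (\<Sum>j\<in>insert i I. Z ((s(i := u)) j))))\<^sup>2) \<partial>M \<partial>Pi\<^sub>M I (\<lambda>_. M))"
    using insert by (subst product_nn_integral_insert) auto
  also have "\<dots> = (\<integral>\<^sup>+s. \<integral>\<^sup>+u. ennreal ((norm ((a + (\<Sum>j\<in>I. Z (s j))) + Z u))\<^sup>2) \<partial>M \<partial>Pi\<^sub>M I (\<lambda>_. M))"
  proof -
    have "(\<Sum>j\<in>I. Z ((s(i := u)) j)) = (\<Sum>j\<in>I. Z (s j))" for s u
      using insert by (intro sum.cong) auto
    then show ?thesis
      using insert by (simp add: ac_simps)
  qed
  also have "\<dots> = (\<integral>\<^sup>+s. ennreal ((norm (a + (\<Sum>j\<in>I. Z (s j))))\<^sup>2) + ennreal ?K \<partial>Pi\<^sub>M I (\<lambda>_. M))"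
    unfolding nn_integral_norm_add[OF Z] by (intro nn_integral_cong ennreal_plus) auto
  also have "\<dots> = ennreal ((norm a)\<^sup>2 + card I * ?K) + ennreal ?K"
    by (subst nn_integral_add) (auto simp: insert.IH P.emeasure_space_1)
  also have "\<dots> = ennreal ((norm a)\<^sup>2 + card (insert i I) * ?K)"
    using insert by (subst ennreal_plus[symmetric]) (auto simp: algebra_simps)
  finally show ?case .
qed

lemma second_moment_iid_average:
  fixes Z :: "'a \<Rightarrow> 'b::euclidean_space"
  assumes "m \<ge> 1"
    and Z: "integrable M Z" "expectation Z = 0" "integrable M (\<lambda>s. (norm (Z s))\<^sup>2)"
  shows "(\<integral>\<^sup>+s. ennreal ((norm (a + (1 / real m) *\<^sub>R (\<Sum>j<m. Z (s j))))\<^sup>2) \<partial>Pi\<^sub>M {..<m} (\<lambda>_. M)) =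
           ennreal ((norm a)\<^sup>2 + expectation (\<lambda>s. (norm (Z s))\<^sup>2) / m)"
proof -
  have "(\<integral>\<^sup>+s. ennreal ((norm (a + (\<Sum>j<m. (1 / real m) *\<^sub>R Z (s j))))\<^sup>2) \<partial>Pi\<^sub>M {..<m} (\<lambda>_. M)) =
      ennreal ((norm a)\<^sup>2 + card {..<m} * expectation (\<lambda>s. (norm ((1 / real m) *\<^sub>R Z s))\<^sup>2))"
    using Z by (intro second_moment_iid_sum) (auto simp: power_divide)
  also have "card {..<m} * expectation (\<lambda>s. (norm ((1 / real m) *\<^sub>R Z s))\<^sup>2) = expectation (\<lambda>s. (norm (Z s))\<^sup>2) / m"
    using \<open>m \<ge> 1\<close> by (simp add: power_divide power2_eq_square)
  finally show ?thesis
    by (simp add: scaleR_sum_right)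
qed

text \<open>Independence makes the joint law a product, as is checked on rectangles; Tonelli then
  averages over \<open>Z\<close> with \<open>Y\<close> frozen. This takes the place of conditioning
  on the past.\<close>

lemma indep_rv_nn_integral:
  assumes indep: "indep_rv M N Y N' Z" and f: "f \<in> borel_measurable (N \<Otimes>\<^sub>M N')"
  shows "(\<integral>\<^sup>+\<omega>. f (Y \<omega>, Z \<omega>) \<partial>M) = (\<integral>\<^sup>+\<omega>. \<integral>\<^sup>+z. f (Y \<omega>, z) \<partial>distr M N' Z \<partial>M)"
proof -
  have [measurable]: "Y \<in> M \<rightarrow>\<^sub>M N" "Z \<in> M \<rightarrow>\<^sub>M N'"
    and set: "indep_set {Y -` A \<inter> space M | A. A \<in> sets N} {Z -` A \<inter> space M | A. A \<in> sets N'}"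
    using indep unfolding indep_rv_def by auto
  note [measurable] = f
  interpret Y: prob_space "distr M N Y"
    by (rule prob_space_distr) measurable
  interpret Z: prob_space "distr M N' Z"
    by (rule prob_space_distr) measurable
  have "distr M N Y \<Otimes>\<^sub>M distr M N' Z = distr M (N \<Otimes>\<^sub>M N') (\<lambda>\<omega>. (Y \<omega>, Z \<omega>))"
  proof (rule pair_measure_eqI)
    fix A B assume "A \<in> sets (distr M N Y)" "B \<in> sets (distr M N' Z)"
    then have AB: "A \<in> sets N" "B \<in> sets N'"
      by auto
    have "(\<lambda>\<omega>. (Y \<omega>, Z \<omega>)) -` (A \<times> B) \<inter> space M = (Y -` A \<inter> space M) \<inter> (Z -` B \<inter> space M)"
      by auto
    moreover have "prob ((Y -` A \<inter> space M) \<inter> (Z -` B \<inter> space M)) = prob (Y -` A \<inter> space M) * prob (Z -` B \<inter> space M)"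
      using AB by (intro indep_setD[OF set]) auto
    ultimately show "emeasure (distr M N Y) A * emeasure (distr M N' Z) B = emeasure (distr M (N \<Otimes>\<^sub>M N') (\<lambda>\<omega>. (Y \<omega>, Z \<omega>))) (A \<times> B)"
      using AB by (simp add: emeasure_distr emeasure_eq_measure ennreal_mult)
  qed (auto intro: Y.sigma_finite_measure_axioms Z.sigma_finite_measure_axioms)
  then have "(\<integral>\<^sup>+\<omega>. f (Y \<omega>, Z \<omega>) \<partial>M) = (\<integral>\<^sup>+p. f p \<partial>(distr M N Y \<Otimes>\<^sub>M distr M N' Z))"
    by (simp add: nn_integral_distr)
  also have "\<dots> = (\<integral>\<^sup>+y. \<integral>\<^sup>+z. f (y, z) \<partial>distr M N' Z \<partial>distr M N Y)"
    by (subst Z.nn_integral_fst[symmetric]) auto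
  also have "\<dots> = (\<integral>\<^sup>+\<omega>. \<integral>\<^sup>+z. f (Y \<omega>, z) \<partial>distr M N' Z \<partial>M)"
    by (subst nn_integral_distr) measurable
  finally show ?thesis .
qed

text \<open>\<open>\<phi>\<close> is the error carried over from the past and \<open>\<psi>\<close>
  the centred contribution of one sample. Once the history is frozen, \<open>\<phi>\<close> is a
  constant shift and the formula for averages of i.i.d. samples applies.\<close>

lemma second_moment_fresh_batch:
  fixes \<phi> :: "'h \<Rightarrow> 'b::euclidean_space" and \<psi> :: "'h \<Rightarrow> 's \<Rightarrow> 'b"
  assumes "prob_space D" and "m \<ge> 1"
    and \<xi>: "\<And>j. j < m \<Longrightarrow> \<xi> j \<in> M \<rightarrow>\<^sub>M D" "\<And>j. j < m \<Longrightarrow> distr M D (\<xi> j) = D" "indep_vars (\<lambda>_. D) \<xi> {..<m}"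
    and indep: "indep_rv M N Y (\<Pi>\<^sub>M j\<in>{..<m}. D) (\<lambda>\<omega>. \<lambda>j\<in>{..<m}. \<xi> j \<omega>)"
    and [measurable]: "\<phi> \<in> borel_measurable N" "(\<lambda>(h, s). \<psi> h s) \<in> borel_measurable (N \<Otimes>\<^sub>M D)"
    and \<psi>: "\<And>h. h \<in> space N \<Longrightarrow> integrable D (\<psi> h)" "\<And>h. h \<in> space N \<Longrightarrow> (\<integral>s. \<psi> h s \<partial>D) = 0"
      "\<And>h. h \<in> space N \<Longrightarrow> integrable D (\<lambda>s. (norm (\<psi> h s))\<^sup>2)"
      "\<And>h. h \<in> space N \<Longrightarrow> (\<integral>s. (norm (\<psi> h s))\<^sup>2 \<partial>D) \<le> \<kappa> h"
  shows "(\<integral>\<^sup>+\<omega>. ennreal ((norm (\<phi> (Y \<omega>) + (1 / real m) *\<^sub>R (\<Sum>j<m. \<psi> (Y \<omega>) (\<xi> j \<omega>))))\<^sup>2) \<partial>M)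
           \<le> (\<integral>\<^sup>+\<omega>. ennreal ((norm (\<phi> (Y \<omega>)))\<^sup>2 + \<kappa> (Y \<omega>) / m) \<partial>M)"
proof -
  interpret D: prob_space D by fact
  let ?P = "\<Pi>\<^sub>M j\<in>{..<m}. D" and ?Z = "\<lambda>\<omega>. \<lambda>j\<in>{..<m}. \<xi> j \<omega>"
  have [measurable]: "Y \<in> M \<rightarrow>\<^sub>M N"
    using indep unfolding indep_rv_def by auto
  \<comment> \<open>Independence within the batch gives a product law; \<open>m \<ge> 1\<close>
    keeps the index set nonempty.\<close>
  have "distr M ?P ?Z = (\<Pi>\<^sub>M j\<in>{..<m}. distr M D (\<xi> j))"
    using \<xi> \<open>m \<ge> 1\<close> by (intro indep_vars_iff_distr_eq_PiM'[THEN iffD1]) (auto simp: lessThan_empty_iff)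
  also have "\<dots> = ?P"
    using \<xi>(2) by (intro PiM_cong) auto
  finally have distr: "distr M ?P ?Z = ?P" .
  define f where "f = (\<lambda>(h, s). ennreal ((norm (\<phi> h + (1 / real m) *\<^sub>R (\<Sum>j<m. \<psi> h (s j))))\<^sup>2))"
  have "(\<lambda>p. \<psi> (fst p) (snd p j)) \<in> borel_measurable (N \<Otimes>\<^sub>M ?P)" if "j < m" for j
  proof -
    have "(\<lambda>p. (fst p, snd p j)) \<in> N \<Otimes>\<^sub>M ?P \<rightarrow>\<^sub>M N \<Otimes>\<^sub>M D"
      by measurable (simp add: that)
    from measurable_compose[OF this, of "\<lambda>(h, s). \<psi> h s" borel] show ?thesis
      by simp
  qed
  then have "f \<in> borel_measurable (N \<Otimes>\<^sub>M ?P)"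
    unfolding f_def split_beta' by measurable
  from indep_rv_nn_integral[OF indep this]
  have "(\<integral>\<^sup>+\<omega>. f (Y \<omega>, ?Z \<omega>) \<partial>M) = (\<integral>\<^sup>+\<omega>. \<integral>\<^sup>+s. f (Y \<omega>, s) \<partial>?P \<partial>M)"
    unfolding distr .
  also have "\<dots> \<le> (\<integral>\<^sup>+\<omega>. ennreal ((norm (\<phi> (Y \<omega>)))\<^sup>2 + \<kappa> (Y \<omega>) / m) \<partial>M)"
  proof (rule nn_integral_mono)
    fix \<omega> assume "\<omega> \<in> space M"
    then have "Y \<omega> \<in> space N"
      by (rule measurable_space[rotated]) measurable
    note \<psi> = \<psi>[OF this]
    show "(\<integral>\<^sup>+s. f (Y \<omega>, s) \<partial>?P) \<le> ennreal ((norm (\<phi> (Y \<omega>)))\<^sup>2 + \<kappa> (Y \<omega>) / m)"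
      unfolding f_def prod.case D.second_moment_iid_average[OF \<open>m \<ge> 1\<close> \<psi>(1-3)]
      using \<psi>(4) by (intro ennreal_leI add_left_mono divide_right_mono) auto
  qed
  finally show ?thesis
    by (simp add: f_def)
qed

end

subsection \<open>Runs of the algorithm\<close>

text \<open>\<open>S\<close> bounds the expected squared error of the estimate \<open>A\<close>, which is the full gradient (finite
  sums) or a batch average (online).\<close>

locale spgr = prob_space M for M :: "'w measure" +
  fixes D :: "'s measure" and fs :: "'s \<Rightarrow> 'a::euclidean_space \<Rightarrow> real" and f :: "'a \<Rightarrow> real"
    and r :: "'a \<Rightarrow> ereal" and L \<eta> S :: real and T q :: nat and b :: "nat \<Rightarrow> nat"
    and A :: "(nat \<Rightarrow> 's) \<Rightarrow> 'a \<Rightarrow> 'a" and x0 :: 'a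
    and \<xi> :: "nat \<Rightarrow> nat \<Rightarrow> 'w \<Rightarrow> 's" and G X :: "nat \<Rightarrow> 'w \<Rightarrow> 'a"
  assumes prob_D: "prob_space D"
    and unbiased: "unbiased_grad D fs f"
    and L_pos: "L > 0" and \<eta>_pos: "\<eta> > 0" and \<eta>L: "3 * \<eta> * L < 1"
    and q_pos: "q \<ge> 1"
    and Lf: "lipschitz_grad L f" and Lfs: "s \<in> space D \<Longrightarrow> lipschitz_grad L (fs s)"
    and r: "proper r" "\<bar>r x0\<bar> \<noteq> \<infinity>"
    and b: "\<not> q dvd t \<Longrightarrow> b t = q"
    and run: "spgr_run fs r \<eta> T q q A x0 M \<xi> G X"
    and fresh: "fresh_batches M D T b \<xi> X"
    and history_T: "history b \<xi> X T \<in> M \<rightarrow>\<^sub>M history_space b D T"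
    and anchor: "A = (\<lambda>_. grad f) \<and> S = 0 \<or>
      (\<exists>m \<sigma>. m \<ge> 1 \<and> A = batch_grad fs m \<and> (\<forall>t. q dvd t \<longrightarrow> b t = m) \<and>
         bounded_grad_variance D fs f \<sigma> \<and> S = \<sigma>\<^sup>2 / m)"
begin

lemma X_0: "\<omega> \<in> space M \<Longrightarrow> X 0 \<omega> = x0"
  using run unfolding spgr_run_def by blast

lemma X_Suc: "\<omega> \<in> space M \<Longrightarrow> t < T \<Longrightarrow> X (Suc t) \<omega> \<in> prox \<eta> r (X t \<omega> - \<eta> *\<^sub>R G t \<omega>)"
  using run unfolding spgr_run_def by blast

lemma G_anchor: "\<omega> \<in> space M \<Longrightarrow> t < T \<Longrightarrow> q dvd t \<Longrightarrow> G t \<omega> = A (\<lambda>j. \<xi> t j \<omega>) (X t \<omega>)"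
  using run unfolding spgr_run_def by simp

lemma G_recursive:
  "\<omega> \<in> space M \<Longrightarrow> t < T \<Longrightarrow> \<not> q dvd t \<Longrightarrow>
    G t \<omega> = batch_grad fs (b t) (\<lambda>j. \<xi> t j \<omega>) (X t \<omega>) - batch_grad fs (b t) (\<lambda>j. \<xi> t j \<omega>) (X (t - 1) \<omega>) + G (t - 1) \<omega>"
  using run b unfolding spgr_run_def by simp

lemma r_X_finite: "\<omega> \<in> space M \<Longrightarrow> t \<le> T \<Longrightarrow> \<bar>r (X t \<omega>)\<bar> \<noteq> \<infinity>"
  using r X_0 prox_finite[OF r(1) X_Suc] by (cases t) auto

lemma S_nonneg: "S \<ge> 0"
  using anchor by auto

lemma grad_measurable[measurable]: "grad f \<in> borel_measurable borel"
  using continuous_on_grad[OF Lf] by (rule borel_measurable_continuous_onI)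

lemma sample_grad_measurable: "(\<lambda>(s, x). grad (fs s) x) \<in> borel_measurable (D \<Otimes>\<^sub>M borel)"
  using unbiased continuous_on_grad[OF Lfs] unfolding unbiased_grad_def
  by (intro borel_measurable_Caratheodory borel_measurable_integrable) auto

lemma sample_grad_measurable'[measurable (raw)]:
  "s \<in> N \<rightarrow>\<^sub>M D \<Longrightarrow> x \<in> borel_measurable N \<Longrightarrow> (\<lambda>\<omega>. grad (fs (s \<omega>)) (x \<omega>)) \<in> borel_measurable N"
  using measurable_compose[OF measurable_Pair sample_grad_measurable, of s N x] by simp

subsection \<open>Functions of the history\<close>

text \<open>Measurability with respect to the history, in factorised form: it turns independence from the
  history into an iterated integral over an independent batch.\<close>

definition hist_fun :: "nat \<Rightarrow> ('w \<Rightarrow> 'c::topological_space) \<Rightarrow> bool" where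
  "hist_fun m Y \<longleftrightarrow> (\<exists>g\<in>borel_measurable (history_space b D m). \<forall>\<omega>\<in>space M. Y \<omega> = g (history b \<xi> X m \<omega>))"

text \<open>\<open>fresh_batches\<close> covers the times before \<open>T\<close>, and
  \<open>history_T\<close> the final one.\<close>

lemma history_measurable: "t \<le> T \<Longrightarrow> history b \<xi> X t \<in> M \<rightarrow>\<^sub>M history_space b D t"
  using fresh history_T unfolding fresh_batches_def indep_rv_def by (cases "t = T") auto

lemma hist_fun_measurable: "hist_fun m Y \<Longrightarrow> m \<le> T \<Longrightarrow> Y \<in> borel_measurable M"
  unfolding hist_fun_def using history_measurable[of m]
  by (metis (no_types, lifting) measurable_cong measurable_compose)

lemma hist_fun_X: "s \<le> m \<Longrightarrow> hist_fun m (X s)"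
  unfolding hist_fun_def history_space_def
  by (rule bexI[of _ "\<lambda>h. fst h s"]) (auto simp: history_def)

lemma hist_fun_cong: "(\<And>\<omega>. \<omega> \<in> space M \<Longrightarrow> Y \<omega> = Z \<omega>) \<Longrightarrow> hist_fun m Y = hist_fun m Z"
  unfolding hist_fun_def by auto

lemma hist_fun_compose:
  assumes "hist_fun m Y" "k \<in> borel_measurable borel"
  shows "hist_fun m (\<lambda>\<omega>. k (Y \<omega>))"
proof -
  obtain g where g: "g \<in> borel_measurable (history_space b D m)" "\<And>\<omega>. \<omega> \<in> space M \<Longrightarrow> Y \<omega> = g (history b \<xi> X m \<omega>)"
    using assms unfolding hist_fun_def by blast
  show ?thesis
    unfolding hist_fun_def
    by (rule bexI[of _ "\<lambda>h. k (g h)"]) (use g assms(2) in \<open>auto intro: measurable_compose\<close>)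
qed

lemma hist_fun_linear:
  fixes Y Z :: "'w \<Rightarrow> 'c::euclidean_space"
  assumes "hist_fun m Y" "hist_fun m Z"
  shows "hist_fun m (\<lambda>\<omega>. \<alpha> *\<^sub>R Y \<omega> + \<beta> *\<^sub>R Z \<omega>)"
proof -
  obtain g h where [measurable]: "g \<in> borel_measurable (history_space b D m)" "h \<in> borel_measurable (history_space b D m)"
    and "\<And>\<omega>. \<omega> \<in> space M \<Longrightarrow> Y \<omega> = g (history b \<xi> X m \<omega>)" "\<And>\<omega>. \<omega> \<in> space M \<Longrightarrow> Z \<omega> = h (history b \<xi> X m \<omega>)"
    using assms unfolding hist_fun_def by blast
  then show ?thesis
    unfolding hist_fun_def by (intro bexI[of _ "\<lambda>p. \<alpha> *\<^sub>R g p + \<beta> *\<^sub>R h p"]) auto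
qed

lemma hist_fun_add:
  fixes Y Z :: "'w \<Rightarrow> 'c::euclidean_space"
  shows "hist_fun m Y \<Longrightarrow> hist_fun m Z \<Longrightarrow> hist_fun m (\<lambda>\<omega>. Y \<omega> + Z \<omega>)"
  using hist_fun_linear[of m Y Z 1 1] by simp

lemma hist_fun_diff:
  fixes Y Z :: "'w \<Rightarrow> 'c::euclidean_space"
  shows "hist_fun m Y \<Longrightarrow> hist_fun m Z \<Longrightarrow> hist_fun m (\<lambda>\<omega>. Y \<omega> - Z \<omega>)"
  using hist_fun_linear[of m Y Z 1 "-1"] by simp

lemma hist_fun_batch_grad:
  assumes "s < m" "hist_fun m Y"
  shows "hist_fun m (\<lambda>\<omega>. batch_grad fs (b s) (\<lambda>j. \<xi> s j \<omega>) (Y \<omega>))"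
proof -
  obtain g where [measurable]: "g \<in> borel_measurable (history_space b D m)"
    and g: "\<And>\<omega>. \<omega> \<in> space M \<Longrightarrow> Y \<omega> = g (history b \<xi> X m \<omega>)"
    using assms unfolding hist_fun_def by blast
  have [measurable]: "(\<lambda>h. snd h (s, j)) \<in> history_space b D m \<rightarrow>\<^sub>M D" if "j < b s" for j
    unfolding history_space_def
    by (rule measurable_compose[OF measurable_snd], rule measurable_component_singleton) (use assms(1) that in auto)
  show ?thesis
    unfolding hist_fun_def
  proof (rule bexI)
    show "\<forall>\<omega>\<in>space M. batch_grad fs (b s) (\<lambda>j. \<xi> s j \<omega>) (Y \<omega>) =
      (\<lambda>h. (1 / real (b s)) *\<^sub>R (\<Sum>j<b s. grad (fs (snd h (s, j))) (g h))) (history b \<xi> X m \<omega>)"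
      using assms(1) by (auto simp: batch_grad_def g history_def intro!: sum.cong)
    show "(\<lambda>h. (1 / real (b s)) *\<^sub>R (\<Sum>j<b s. grad (fs (snd h (s, j))) (g h))) \<in> borel_measurable (history_space b D m)"
      by (intro borel_measurable_scaleR borel_measurable_const borel_measurable_sum sample_grad_measurable') auto
  qed
qed

lemma hist_fun_G_anchor:
  assumes "t < m" "m \<le> T" "q dvd t"
  shows "hist_fun m (G t)"
  using anchor
proof (elim disjE exE conjE)
  assume "A = (\<lambda>_. grad f)"
  moreover have "hist_fun m (\<lambda>\<omega>. grad f (X t \<omega>))"
    using assms by (intro hist_fun_compose[OF hist_fun_X]) auto
  ultimately show ?thesis
    using assms G_anchor by (subst hist_fun_cong) auto
next
  fix k assume "A = batch_grad fs k" "\<forall>t. q dvd t \<longrightarrow> b t = k"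
  moreover have "hist_fun m (\<lambda>\<omega>. batch_grad fs (b t) (\<lambda>j. \<xi> t j \<omega>) (X t \<omega>))"
    using assms by (intro hist_fun_batch_grad hist_fun_X) auto
  ultimately show ?thesis
    using assms G_anchor by (subst hist_fun_cong) auto
qed

text \<open>The inequality \<open>t < m\<close> is strict because the history at time
  \<open>m\<close> records the iterate \<open>X m\<close> but only the batches drawn before
  \<open>m\<close>.\<close>

lemma hist_fun_G:
  assumes "t < m" "m \<le> T"
  shows "hist_fun m (G t)"
  using assms
proof (induction t)
  case 0
  then show ?case
    using hist_fun_G_anchor by simp
next
  case (Suc t)
  show ?case
  proof (cases "q dvd Suc t")
    case True
    then show ?thesis
      using hist_fun_G_anchor Suc.prems by blast
  next
    case False
    have "hist_fun m (\<lambda>\<omega>. batch_grad fs (b (Suc t)) (\<lambda>j. \<xi> (Suc t) j \<omega>) (X (Suc t) \<omega>)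
       - batch_grad fs (b (Suc t)) (\<lambda>j. \<xi> (Suc t) j \<omega>) (X t \<omega>) + G t \<omega>)"
      using Suc by (intro hist_fun_add hist_fun_diff hist_fun_batch_grad hist_fun_X) auto
    then show ?thesis
      using Suc.prems False G_recursive[of _ "Suc t"] by (subst hist_fun_cong) auto
  qed
qed

subsection \<open>Accumulation of the estimation error\<close>

definition err :: "nat \<Rightarrow> 'w \<Rightarrow> 'a" where
  "err t \<omega> = G t \<omega> - grad f (X t \<omega>)"

definition step :: "nat \<Rightarrow> 'w \<Rightarrow> 'a" where
  "step t \<omega> = X (Suc t) \<omega> - X t \<omega>"

text \<open>The index is that of the step, not of the point: this vector belongs to
  \<open>X (Suc t)\<close>, so the output index \<open>R\<close> will correspond to
  \<open>subgrad (R - 1)\<close>.\<close>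

definition subgrad :: "nat \<Rightarrow> 'w \<Rightarrow> 'a" where
  "subgrad t \<omega> = grad f (X (Suc t) \<omega>) + (1 / \<eta>) *\<^sub>R (X t \<omega> - \<eta> *\<^sub>R G t \<omega> - X (Suc t) \<omega>)"

text \<open>Valued in \<open>ennreal\<close> because square-integrability of errors and steps is not
  known in advance; it emerges in \<open>expected_steps_finite\<close>.\<close>

definition second_moment :: "('w \<Rightarrow> 'a) \<Rightarrow> ennreal" where
  "second_moment Y = (\<integral>\<^sup>+\<omega>. ennreal ((norm (Y \<omega>))\<^sup>2) \<partial>M)"

lemma hist_fun_err: "t < m \<Longrightarrow> m \<le> T \<Longrightarrow> hist_fun m (err t)"
  unfolding err_def[abs_def] by (intro hist_fun_diff hist_fun_G hist_fun_compose[OF hist_fun_X]) auto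

lemma hist_fun_step: "t < m \<Longrightarrow> hist_fun m (step t)"
  unfolding step_def[abs_def] by (intro hist_fun_diff hist_fun_X) auto

lemma hist_fun_subgrad: "t < T \<Longrightarrow> hist_fun T (subgrad t)"
proof -
  assume "t < T"
  then have "hist_fun T (\<lambda>\<omega>. grad f (X (Suc t) \<omega>) + (1 *\<^sub>R ((1 / \<eta>) *\<^sub>R X t \<omega> + (- 1) *\<^sub>R G t \<omega>) + (- 1 / \<eta>) *\<^sub>R X (Suc t) \<omega>))"
    by (intro hist_fun_add hist_fun_linear hist_fun_G hist_fun_compose[OF hist_fun_X] hist_fun_X) auto
  then show ?thesis
    using \<eta>_pos unfolding subgrad_def[abs_def] by (simp add: algebra_simps)
qed

lemma err_measurable[measurable]: "t < T \<Longrightarrow> err t \<in> borel_measurable M"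
  using hist_fun_measurable hist_fun_err by blast

lemma step_measurable[measurable]: "t < T \<Longrightarrow> step t \<in> borel_measurable M"
  using hist_fun_measurable hist_fun_step by blast

lemma subgrad_measurable[measurable]: "t < T \<Longrightarrow> subgrad t \<in> borel_measurable M"
  using hist_fun_measurable hist_fun_subgrad by blast

lemma second_moment_batch:
  assumes "t < T" "b t \<ge> 1"
    and "\<phi> \<in> borel_measurable (history_space b D t)"
      "(\<lambda>(h, s). \<psi> h s) \<in> borel_measurable (history_space b D t \<Otimes>\<^sub>M D)"
    and "\<And>h. integrable D (\<psi> h)" "\<And>h. (\<integral>s. \<psi> h s \<partial>D) = 0"
      "\<And>h. integrable D (\<lambda>s. (norm (\<psi> h s))\<^sup>2)"
      "\<And>h. (\<integral>s. (norm (\<psi> h s))\<^sup>2 \<partial>D) \<le> \<kappa> h"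
  shows "second_moment (\<lambda>\<omega>. \<phi> (history b \<xi> X t \<omega>) + (1 / real (b t)) *\<^sub>R (\<Sum>j<b t. \<psi> (history b \<xi> X t \<omega>) (\<xi> t j \<omega>)))
           \<le> (\<integral>\<^sup>+\<omega>. ennreal ((norm (\<phi> (history b \<xi> X t \<omega>)))\<^sup>2 + \<kappa> (history b \<xi> X t \<omega>) / b t) \<partial>M)"
  unfolding second_moment_def
  using fresh assms unfolding fresh_batches_def
  by (intro second_moment_fresh_batch[OF prob_D]) auto

lemma err_anchor:
  assumes t: "t < T" "q dvd t"
  shows "second_moment (err t) \<le> ennreal S"
  using anchor
proof (elim disjE exE conjE)
  assume A: "A = (\<lambda>_. grad f)" "S = 0"
  have "second_moment (err t) = (\<integral>\<^sup>+\<omega>. 0 \<partial>M)"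
    unfolding second_moment_def using G_anchor[OF _ t] by (intro nn_integral_cong) (simp add: err_def A(1))
  then show ?thesis
    by simp
next
  fix m \<sigma> assume m: "m \<ge> 1" "A = batch_grad fs m" "\<forall>t. q dvd t \<longrightarrow> b t = m"
    and var: "bounded_grad_variance D fs f \<sigma>" and S: "S = \<sigma>\<^sup>2 / m"
  have bt: "b t = m"
    using m(3) t(2) by blast
  obtain g where [measurable]: "g \<in> borel_measurable (history_space b D t)"
    and g: "\<And>\<omega>. \<omega> \<in> space M \<Longrightarrow> X t \<omega> = g (history b \<xi> X t \<omega>)"
    using hist_fun_X[of t t] unfolding hist_fun_def by blast
  interpret D: prob_space D
    by (rule prob_D)
  define \<psi> where "\<psi> h s = grad (fs s) (g h) - grad f (g h)" for h s
  \<comment> \<open>No error is carried over at the start of an epoch, so 0 plays the role of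
    \<open>\<phi>\<close>.\<close>
  have "err t \<omega> = 0 + (1 / real (b t)) *\<^sub>R (\<Sum>j<b t. \<psi> (history b \<xi> X t \<omega>) (\<xi> t j \<omega>))" if "\<omega> \<in> space M" for \<omega>
    using m(1) bt g[OF that] G_anchor[OF that t]
    by (simp add: err_def \<psi>_def m(2) batch_grad_def sum_subtractf scaleR_diff_right sum_constant_scaleR)
  then have "second_moment (err t) = second_moment (\<lambda>\<omega>. 0 + (1 / real (b t)) *\<^sub>R (\<Sum>j<b t. \<psi> (history b \<xi> X t \<omega>) (\<xi> t j \<omega>)))"
    unfolding second_moment_def by (intro nn_integral_cong) auto
  also have "\<dots> \<le> (\<integral>\<^sup>+\<omega>. ennreal ((norm (0::'a))\<^sup>2 + \<sigma>\<^sup>2 / b t) \<partial>M)"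
  proof (rule second_moment_batch[OF t(1)])
    show "(\<lambda>(h, s). \<psi> h s) \<in> borel_measurable (history_space b D t \<Otimes>\<^sub>M D)"
      unfolding \<psi>_def by measurable
    show "integrable D (\<psi> h)" "(\<integral>s. \<psi> h s \<partial>D) = 0" for h
      using unbiased unfolding unbiased_grad_def \<psi>_def[abs_def] by (auto simp: D.prob_space)
    show "integrable D (\<lambda>s. (norm (\<psi> h s))\<^sup>2)" "(\<integral>s. (norm (\<psi> h s))\<^sup>2 \<partial>D) \<le> \<sigma>\<^sup>2" for h
      using var unfolding bounded_grad_variance_def \<psi>_def by auto
  qed (use m bt in auto)
  also have "\<dots> = ennreal S"
    by (simp add: emeasure_space_1 S bt)
  finally show ?thesis .
qed

text \<open>The new error is the old one plus an average of \<open>q\<close> centred gradient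
  differences. The old error is a function of the history, so no cross term survives; each
  difference has variance at most its second moment, which the Lipschitz condition bounds, and
  averaging divides by \<open>q\<close>.\<close>

lemma err_recursive:
  assumes t: "t < T" "\<not> q dvd t"
  shows "second_moment (err t) \<le> second_moment (err (t - 1)) + ennreal (L\<^sup>2 / q) * second_moment (step (t - 1))"
proof -
  \<comment> \<open>\<open>q\<close> divides 0, so here \<open>t - 1\<close> is a genuine
    predecessor.\<close>
  have t0: "t > 0" "Suc (t - 1) = t"
    using t(2) by (cases t; simp)+
  have bt: "b t = q"
    using t(2) by (rule b)
  let ?H = "history b \<xi> X t"
  obtain g where [measurable]: "g \<in> borel_measurable (history_space b D t)"
    and g: "\<And>\<omega>. \<omega> \<in> space M \<Longrightarrow> X t \<omega> = g (?H \<omega>)"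
    using hist_fun_X[of t t] unfolding hist_fun_def by blast
  obtain g' where [measurable]: "g' \<in> borel_measurable (history_space b D t)"
    and g': "\<And>\<omega>. \<omega> \<in> space M \<Longrightarrow> X (t - 1) \<omega> = g' (?H \<omega>)"
    using hist_fun_X[of "t - 1" t] unfolding hist_fun_def by auto
  obtain \<phi> where [measurable]: "\<phi> \<in> borel_measurable (history_space b D t)"
    and \<phi>: "\<And>\<omega>. \<omega> \<in> space M \<Longrightarrow> err (t - 1) \<omega> = \<phi> (?H \<omega>)"
    using hist_fun_err[of "t - 1" t] t t0 unfolding hist_fun_def by auto
  interpret D: prob_space D
    by (rule prob_D)
  define \<delta> where "\<delta> h s = grad (fs s) (g h) - grad (fs s) (g' h)" for h s
  define \<psi> where "\<psi> h s = \<delta> h s - (grad f (g h) - grad f (g' h))" for h s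
  have \<delta>: "(\<integral>s. \<delta> h s \<partial>D) = grad f (g h) - grad f (g' h)" "\<delta> h \<in> borel_measurable D" for h
    using unbiased unfolding unbiased_grad_def \<delta>_def[abs_def] by auto
  have \<delta>_le: "norm (\<delta> h s) \<le> L * norm (g h - g' h)" if "s \<in> space D" for h s
    using Lfs[OF that] unfolding lipschitz_grad_def \<delta>_def by blast
  have "err t \<omega> = \<phi> (?H \<omega>) + (1 / real (b t)) *\<^sub>R (\<Sum>j<b t. \<psi> (?H \<omega>) (\<xi> t j \<omega>))" if "\<omega> \<in> space M" for \<omega>
  proof -
    have "(1 / real (b t)) *\<^sub>R (\<Sum>j<b t. \<psi> (?H \<omega>) (\<xi> t j \<omega>)) =
        (batch_grad fs (b t) (\<lambda>j. \<xi> t j \<omega>) (X t \<omega>) - batch_grad fs (b t) (\<lambda>j. \<xi> t j \<omega>) (X (t - 1) \<omega>))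
          - (grad f (X t \<omega>) - grad f (X (t - 1) \<omega>))"
      using q_pos bt g[OF that] g'[OF that]
      by (simp add: \<psi>_def \<delta>_def batch_grad_def sum_subtractf scaleR_diff_right sum_constant_scaleR)
    then show ?thesis
      unfolding \<phi>[OF that, symmetric] by (simp add: err_def G_recursive[OF that t])
  qed
  then have "second_moment (err t) = second_moment (\<lambda>\<omega>. \<phi> (?H \<omega>) + (1 / real (b t)) *\<^sub>R (\<Sum>j<b t. \<psi> (?H \<omega>) (\<xi> t j \<omega>)))"
    unfolding second_moment_def by (intro nn_integral_cong) auto
  also have "\<dots> \<le> (\<integral>\<^sup>+\<omega>. ennreal ((norm (\<phi> (?H \<omega>)))\<^sup>2 + (L * norm (g (?H \<omega>) - g' (?H \<omega>)))\<^sup>2 / b t) \<partial>M)"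
  proof (rule second_moment_batch[OF t(1)])
    show "(\<lambda>(h, s). \<psi> h s) \<in> borel_measurable (history_space b D t \<Otimes>\<^sub>M D)"
      unfolding \<psi>_def \<delta>_def by measurable
    show "integrable D (\<psi> h)" "(\<integral>s. \<psi> h s \<partial>D) = 0" for h
      using unbiased unfolding unbiased_grad_def \<psi>_def[abs_def] \<delta>_def by (auto simp: D.prob_space)
    show "integrable D (\<lambda>s. (norm (\<psi> h s))\<^sup>2)" "(\<integral>s. (norm (\<psi> h s))\<^sup>2 \<partial>D) \<le> (L * norm (g h - g' h))\<^sup>2" for h
      using D.centered_second_moment_le[OF \<delta>(2) \<delta>_le, of h] unfolding \<psi>_def \<delta>(1) by auto
  qed (use bt q_pos in auto)
  also have "\<dots> = (\<integral>\<^sup>+\<omega>. ennreal ((norm (err (t - 1) \<omega>))\<^sup>2) + ennreal (L\<^sup>2 / q) * ennreal ((norm (step (t - 1) \<omega>))\<^sup>2) \<partial>M)"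
    using g g' \<phi> t0 bt
    by (intro nn_integral_cong) (simp add: step_def power_mult_distrib flip: ennreal_mult ennreal_plus)
  also have "\<dots> = second_moment (err (t - 1)) + ennreal (L\<^sup>2 / q) * second_moment (step (t - 1))"
  proof -
    have [measurable]: "err (t - 1) \<in> borel_measurable M" "step (t - 1) \<in> borel_measurable M"
      using t by (auto intro!: err_measurable step_measurable)
    show ?thesis
      unfolding second_moment_def by (simp add: nn_integral_add nn_integral_cmult del: One_nat_def)
  qed
  finally show ?thesis .
qed

text \<open>Unrolls \<open>err_recursive\<close> back to the last multiple of \<open>q\<close>;
  times with equal quotient by \<open>q\<close> form one epoch.\<close>

lemma err_epoch:
  assumes "t < T"
  shows "second_moment (err t) \<le> ennreal S + ennreal (L\<^sup>2 / q) * (\<Sum>s | s < t \<and> s div q = t div q. second_moment (step s))"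
  using assms
proof (induction t)
  case 0
  then show ?case
    using err_anchor[of 0] by simp
next
  case (Suc t)
  show ?case
  proof (cases "q dvd Suc t")
    case True
    then show ?thesis
      by (intro order_trans[OF err_anchor[OF Suc.prems True]]) simp
  next
    case False
    then have div: "Suc t div q = t div q"
      by (simp add: div_Suc dvd_eq_mod_eq_0)
    then have set: "{s. s < Suc t \<and> s div q = Suc t div q} = insert t {s. s < t \<and> s div q = t div q}"
      by auto
    let ?\<Sigma> = "\<Sum>s | s < t \<and> s div q = t div q. second_moment (step s)"
    have "second_moment (err (Suc t)) \<le> second_moment (err t) + ennreal (L\<^sup>2 / q) * second_moment (step t)"
      using err_recursive[OF Suc.prems False] by simp
    also have "\<dots> \<le> (ennreal S + ennreal (L\<^sup>2 / q) * ?\<Sigma>) + ennreal (L\<^sup>2 / q) * second_moment (step t)"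
      using Suc by (intro add_right_mono) simp
    also have "\<dots> = ennreal S + ennreal (L\<^sup>2 / q) * (second_moment (step t) + ?\<Sigma>)"
      by (simp only: distrib_left add.assoc add.commute[of "ennreal (L\<^sup>2 / q) * ?\<Sigma>"])
    finally show ?thesis
      unfolding set by simp
  qed
qed

text \<open>After exchanging the sums, each step is charged to at most \<open>q\<close> errors,
  namely those of its own epoch, and this cancels the factor \<open>1 / q\<close>.\<close>

lemma sum_err_le:
  assumes "k \<le> T"
  shows "(\<Sum>t<k. second_moment (err t)) \<le> ennreal (k * S) + ennreal (L\<^sup>2) * (\<Sum>t<k. second_moment (step t))"
proof -
  let ?Q = "\<lambda>s. second_moment (step s)"
  have "(\<Sum>t<k. second_moment (err t)) \<le> (\<Sum>t<k. ennreal S + ennreal (L\<^sup>2 / q) * (\<Sum>s<k. if s div q = t div q then ?Q s else 0))"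
  proof (rule sum_mono)
    fix t assume "t \<in> {..<k}"
    \<comment> \<open>Enlarging \<open>s < t\<close> to \<open>s < k\<close> makes the double sum
      rectangular, ready for the exchange.\<close>
    then have "(\<Sum>s | s < t \<and> s div q = t div q. ?Q s) \<le> (\<Sum>s | s < k \<and> s div q = t div q. ?Q s)"
      by (intro sum_mono2) auto
    also have "\<dots> = (\<Sum>s<k. if s div q = t div q then ?Q s else 0)"
      by (subst sum.inter_filter[symmetric]) auto
    finally show "second_moment (err t) \<le> ennreal S + ennreal (L\<^sup>2 / q) * (\<Sum>s<k. if s div q = t div q then ?Q s else 0)"
      using err_epoch[of t] \<open>t \<in> {..<k}\<close> assms
      by (meson add_left_mono lessThan_iff mult_left_mono order_less_le_trans order_trans zero_le)
  qed
  also have "\<dots> = ennreal (k * S) + ennreal (L\<^sup>2 / q) * (\<Sum>s<k. \<Sum>t<k. if s div q = t div q then ?Q s else 0)"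
    using S_nonneg by (subst sum.swap) (simp add: sum.distrib sum_distrib_left ennreal_mult' ennreal_of_nat_eq_real_of_nat)
  also have "(\<Sum>s<k. \<Sum>t<k. if s div q = t div q then ?Q s else 0) \<le> (\<Sum>s<k. of_nat q * ?Q s)"
  proof (rule sum_mono)
    fix s
    \<comment> \<open>The epoch of \<open>s\<close> lies in a block of \<open>q\<close> consecutive
      times.\<close>
    have "{t \<in> {..<k}. s div q = t div q} \<subseteq> {s div q * q..<s div q * q + q}"
      using q_pos dividend_less_div_times[of q] by (auto simp: add.commute)
    from card_mono[OF _ this] have "card {t \<in> {..<k}. s div q = t div q} \<le> q"
      by simp
    then have "of_nat (card {t \<in> {..<k}. s div q = t div q}) * ?Q s \<le> of_nat q * ?Q s"
      by (intro mult_right_mono) (auto simp: of_nat_mono)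
    then show "(\<Sum>t<k. if s div q = t div q then ?Q s else 0) \<le> of_nat q * ?Q s"
      by (simp add: sum.inter_filter[symmetric])
  qed
  also have "ennreal (L\<^sup>2 / q) * (\<Sum>s<k. of_nat q * ?Q s) = ennreal (L\<^sup>2) * (\<Sum>s<k. ?Q s)"
    using q_pos
    by (simp add: sum_distrib_left[symmetric] mult.assoc[symmetric] ennreal_of_nat_eq_real_of_nat flip: ennreal_mult)
  finally show ?thesis
    by (simp add: add_left_mono mult_left_mono)
qed

subsection \<open>Expected descent\<close>

text \<open>Real-valued form of the objective, faithful only where \<open>r\<close> is finite
  because \<open>real_of_ereal\<close> sends infinite values to 0. By \<open>r_X_finite\<close> the
  iterates stay in that region.\<close>

definition \<Phi> :: "'a \<Rightarrow> real" where
  "\<Phi> x = f x + real_of_ereal (r x)"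

lemma step_descent:
  assumes "\<omega> \<in> space M" "t < T"
  shows "\<Phi> (X (Suc t) \<omega>) + (1 - 2 * \<eta> * L) / (2 * \<eta>) * (norm (step t \<omega>))\<^sup>2 \<le> \<Phi> (X t \<omega>) + (norm (err t \<omega>))\<^sup>2 / (2 * L)"
    and "(norm (subgrad t \<omega>))\<^sup>2 \<le> (2 * L\<^sup>2 + 1 / \<eta>\<^sup>2 + 2 * L / \<eta>) * (norm (step t \<omega>))\<^sup>2
           + 2 * (norm (err t \<omega>))\<^sup>2 + 2 / \<eta> * (\<Phi> (X t \<omega>) - \<Phi> (X (Suc t) \<omega>))"
proof -
  have "\<eta> * L < 1"
    using \<eta>L L_pos \<eta>_pos mult_pos_pos[OF \<eta>_pos L_pos] by linarith
  note prox_descent[OF \<eta>_pos L_pos this Lf r_X_finite[OF assms(1)] r_X_finite[OF assms(1)] X_Suc[OF assms]]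
  then show "\<Phi> (X (Suc t) \<omega>) + (1 - 2 * \<eta> * L) / (2 * \<eta>) * (norm (step t \<omega>))\<^sup>2 \<le> \<Phi> (X t \<omega>) + (norm (err t \<omega>))\<^sup>2 / (2 * L)"
    and "(norm (subgrad t \<omega>))\<^sup>2 \<le> (2 * L\<^sup>2 + 1 / \<eta>\<^sup>2 + 2 * L / \<eta>) * (norm (step t \<omega>))\<^sup>2
           + 2 * (norm (err t \<omega>))\<^sup>2 + 2 / \<eta> * (\<Phi> (X t \<omega>) - \<Phi> (X (Suc t) \<omega>))"
    using assms unfolding \<Phi>_def step_def err_def subgrad_def by simp_all
qed

lemma sum_steps_le:
  assumes "\<omega> \<in> space M" "k \<le> T"
  shows "\<Phi> (X k \<omega>) + (1 - 2 * \<eta> * L) / (2 * \<eta>) * (\<Sum>t<k. (norm (step t \<omega>))\<^sup>2)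
           \<le> \<Phi> x0 + 1 / (2 * L) * (\<Sum>t<k. (norm (err t \<omega>))\<^sup>2)"
  using assms(2)
proof (induction k)
  case 0
  then show ?case
    using X_0[OF assms(1)] by simp
next
  case (Suc k)
  then show ?case
    using step_descent(1)[OF assms(1), of k] by (simp add: distrib_left)
qed

lemma sum_subgrad_le:
  assumes "\<omega> \<in> space M" "k \<le> T"
  shows "(\<Sum>t<k. (norm (subgrad t \<omega>))\<^sup>2) \<le> 2 / \<eta> * (\<Phi> x0 - \<Phi> (X k \<omega>))
           + (2 * L\<^sup>2 + 1 / \<eta>\<^sup>2 + 2 * L / \<eta>) * (\<Sum>t<k. (norm (step t \<omega>))\<^sup>2) + 2 * (\<Sum>t<k. (norm (err t \<omega>))\<^sup>2)"
proof -
  define \<beta> c where "\<beta> = 2 / \<eta>" and "c = 2 * L\<^sup>2 + 1 / \<eta>\<^sup>2 + 2 * L / \<eta>"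
  have "(norm (subgrad t \<omega>))\<^sup>2 \<le> c * (norm (step t \<omega>))\<^sup>2 + 2 * (norm (err t \<omega>))\<^sup>2 + \<beta> * (\<Phi> (X t \<omega>) - \<Phi> (X (Suc t) \<omega>))"
    if "t < T" for t
    using step_descent(2)[OF assms(1) that] unfolding \<beta>_def c_def .
  then have "(\<Sum>t<k. (norm (subgrad t \<omega>))\<^sup>2) \<le>
      (\<Sum>t<k. c * (norm (step t \<omega>))\<^sup>2 + 2 * (norm (err t \<omega>))\<^sup>2 + \<beta> * (\<Phi> (X t \<omega>) - \<Phi> (X (Suc t) \<omega>)))"
    using assms(2) by (intro sum_mono) auto
  also have "\<dots> = c * (\<Sum>t<k. (norm (step t \<omega>))\<^sup>2) + 2 * (\<Sum>t<k. (norm (err t \<omega>))\<^sup>2) + \<beta> * (\<Sum>t<k. \<Phi> (X t \<omega>) - \<Phi> (X (Suc t) \<omega>))"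
    by (simp only: sum.distrib sum_distrib_left)
  also have "(\<Sum>t<k. \<Phi> (X t \<omega>) - \<Phi> (X (Suc t) \<omega>)) = \<Phi> x0 - \<Phi> (X k \<omega>)"
    using sum_lessThan_telescope'[of "\<lambda>t. \<Phi> (X t \<omega>)" k] X_0[OF assms(1)] by simp
  finally show ?thesis
    unfolding \<beta>_def c_def by (simp only: ac_simps)
qed

text \<open>All summands are nonnegative, so the integral splits in \<open>ennreal\<close> without
  any integrability.\<close>

lemma nn_integral_affine:
  assumes "0 \<le> \<Delta>" "0 \<le> c" "0 \<le> c'" "k \<le> T"
  shows "(\<integral>\<^sup>+\<omega>. ennreal (\<Delta> + c * (\<Sum>t<k. (norm (step t \<omega>))\<^sup>2) + c' * (\<Sum>t<k. (norm (err t \<omega>))\<^sup>2)) \<partial>M) =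
    ennreal \<Delta> + ennreal c * (\<Sum>t<k. second_moment (step t)) + ennreal c' * (\<Sum>t<k. second_moment (err t))"
proof -
  have [measurable]: "step t \<in> borel_measurable M" "err t \<in> borel_measurable M" if "t \<in> {..<k}" for t
    using that assms(4) by (auto intro!: step_measurable err_measurable)
  have eq: "ennreal (\<Delta> + c * (\<Sum>t<k. (norm (step t \<omega>))\<^sup>2) + c' * (\<Sum>t<k. (norm (err t \<omega>))\<^sup>2)) =
     ennreal \<Delta> + ennreal c * (\<Sum>t<k. ennreal ((norm (step t \<omega>))\<^sup>2)) + ennreal c' * (\<Sum>t<k. ennreal ((norm (err t \<omega>))\<^sup>2))" for \<omega>
    using assms by (simp add: ennreal_plus ennreal_mult sum_nonneg)
  have "(\<lambda>\<omega>. \<Sum>t<k. ennreal ((norm (step t \<omega>))\<^sup>2)) \<in> borel_measurable M" "(\<lambda>\<omega>. \<Sum>t<k. ennreal ((norm (err t \<omega>))\<^sup>2)) \<in> borel_measurable M"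
    by measurable
  then show ?thesis
    unfolding eq second_moment_def
    by (simp add: nn_integral_add nn_integral_cmult nn_integral_sum emeasure_space_1 del: sum_ennreal)
qed

context
  fixes \<Delta> :: real
  assumes bounded: "\<And>x. \<bar>r x\<bar> \<noteq> \<infinity> \<Longrightarrow> \<Phi> x0 - \<Phi> x \<le> \<Delta>"
begin

lemma \<Delta>_nonneg: "0 \<le> \<Delta>"
  using bounded[OF r(2)] by simp

lemma expected_steps_le:
  assumes "k \<le> T"
  shows "ennreal ((1 - 2 * \<eta> * L) / (2 * \<eta>)) * (\<Sum>t<k. second_moment (step t))
           \<le> ennreal \<Delta> + ennreal (1 / (2 * L)) * (\<Sum>t<k. second_moment (err t))"
proof -
  let ?\<alpha> = "(1 - 2 * \<eta> * L) / (2 * \<eta>)"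
  have "0 \<le> ?\<alpha>"
    using \<eta>L \<eta>_pos mult_pos_pos[OF \<eta>_pos L_pos] by simp
  then have "ennreal ?\<alpha> * (\<Sum>t<k. second_moment (step t)) =
      (\<integral>\<^sup>+\<omega>. ennreal (0 + ?\<alpha> * (\<Sum>t<k. (norm (step t \<omega>))\<^sup>2) + 0 * (\<Sum>t<k. (norm (err t \<omega>))\<^sup>2)) \<partial>M)"
    using assms by (subst nn_integral_affine) auto
  also have "\<dots> \<le> (\<integral>\<^sup>+\<omega>. ennreal (\<Delta> + 0 * (\<Sum>t<k. (norm (step t \<omega>))\<^sup>2) + 1 / (2 * L) * (\<Sum>t<k. (norm (err t \<omega>))\<^sup>2)) \<partial>M)"
    using sum_steps_le[OF _ assms] bounded[OF r_X_finite[OF _ assms]]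
    by (intro nn_integral_mono ennreal_leI) (smt (verit) mult_zero_left)
  also have "\<dots> = ennreal \<Delta> + ennreal (1 / (2 * L)) * (\<Sum>t<k. second_moment (err t))"
    using assms L_pos \<Delta>_nonneg by (subst nn_integral_affine) auto
  finally show ?thesis .
qed

text \<open>Errors are bounded by steps and steps by errors, and a term can be absorbed from one
  side into the other only if it is finite. The induction breaks the circle: errors before
  \<open>Suc k\<close> involve only steps before \<open>k\<close>, and the descent then controls one
  more step.\<close>

lemma expected_steps_finite:
  "k \<le> T \<Longrightarrow> (\<Sum>t<k. second_moment (step t)) < \<infinity>"
proof (induction k)
  case (Suc k)
  let ?\<alpha> = "(1 - 2 * \<eta> * L) / (2 * \<eta>)"
  have "0 < ?\<alpha>"
    using \<eta>L \<eta>_pos mult_pos_pos[OF \<eta>_pos L_pos] by simp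
  have err: "second_moment (err s) < \<infinity>" if "s < Suc k" for s
  proof -
    \<comment> \<open>Only steps before \<open>s\<close> enter, and \<open>s \<le> k\<close>, so the
      induction hypothesis covers them.\<close>
    have "(\<Sum>u | u < s \<and> u div q = s div q. second_moment (step u)) \<le> (\<Sum>u<k. second_moment (step u))"
      using that by (intro sum_mono2) auto
    also have "\<dots> < \<infinity>"
      using Suc by simp
    finally have "ennreal S + ennreal (L\<^sup>2 / q) * (\<Sum>u | u < s \<and> u div q = s div q. second_moment (step u)) < \<infinity>"
      by (simp add: ennreal_mult_less_top)
    then show ?thesis
      using err_epoch[of s] that Suc.prems by (simp add: le_less_trans)
  qed
  then have "(\<Sum>t<Suc k. second_moment (err t)) < \<infinity>"
    by (simp del: sum.lessThan_Suc)
  then have "ennreal \<Delta> + ennreal (1 / (2 * L)) * (\<Sum>t<Suc k. second_moment (err t)) < \<infinity>"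
    by (simp add: ennreal_mult_less_top del: sum.lessThan_Suc)
  then have "ennreal ?\<alpha> * (\<Sum>t<Suc k. second_moment (step t)) < \<infinity>"
    by (rule le_less_trans[OF expected_steps_le[OF Suc.prems]])
  then show ?case
    using \<open>0 < ?\<alpha>\<close> by (auto simp: ennreal_mult_less_top ennreal_eq_0_iff simp del: sum.lessThan_Suc)
qed simp

text \<open>With \<open>Q\<close> the total expected squared step, the descent and the error bound
  give a linear inequality with \<open>Q\<close> on both sides. Solving it bounds
  \<open>\<theta> * Q\<close>, and this is inserted into the integrated form of
  \<open>sum_subgrad_le\<close>.\<close>

lemma expected_subgrad_le:
  defines "\<theta> \<equiv> (1 - 3 * \<eta> * L) / (2 * \<eta>)" and "\<gamma> \<equiv> 4 * L\<^sup>2 + 1 / \<eta>\<^sup>2 + 2 * L / \<eta>"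
  shows "(\<Sum>t<T. second_moment (subgrad t)) \<le> ennreal (2 / \<eta> * \<Delta> + \<gamma> / \<theta> * (\<Delta> + T * S / (2 * L)) + 2 * (T * S))"
proof -
  let ?\<alpha> = "(1 - 2 * \<eta> * L) / (2 * \<eta>)" and ?c = "2 * L\<^sup>2 + 1 / \<eta>\<^sup>2 + 2 * L / \<eta>"
  \<comment> \<open>The surplus \<open>L / 2\<close> of the descent coefficient over
    \<open>\<theta>\<close> is exactly what absorbs the error term
    \<open>L\<^sup>2 * Q / (2 * L)\<close>.\<close>
  have \<theta>: "0 < \<theta>" and \<alpha>: "?\<alpha> = \<theta> + L / 2" "0 \<le> ?\<alpha>"
    using \<eta>L \<eta>_pos mult_pos_pos[OF \<eta>_pos L_pos] by (auto simp: \<theta>_def field_simps)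
  have c: "0 \<le> ?c"
    using L_pos \<eta>_pos by simp
  have S: "0 \<le> T * S"
    using S_nonneg by simp
  \<comment> \<open>Finiteness allows the passage to a real number, where subtraction is
    legitimate.\<close>
  obtain Q where Q: "0 \<le> Q" "(\<Sum>t<T. second_moment (step t)) = ennreal Q"
    using expected_steps_finite[of T] by (cases "\<Sum>t<T. second_moment (step t)") auto
  have err: "(\<Sum>t<T. second_moment (err t)) \<le> ennreal (T * S + L\<^sup>2 * Q)"
    using sum_err_le[of T] Q S by (simp add: ennreal_mult)
  have "ennreal (?\<alpha> * Q) \<le> ennreal \<Delta> + ennreal (1 / (2 * L)) * (\<Sum>t<T. second_moment (err t))"
    unfolding ennreal_mult[OF \<alpha>(2) Q(1)] Q(2)[symmetric] by (rule expected_steps_le) simp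
  also have "\<dots> \<le> ennreal \<Delta> + ennreal (1 / (2 * L)) * ennreal (T * S + L\<^sup>2 * Q)"
    using err by (intro add_left_mono mult_left_mono) auto
  also have "\<dots> = ennreal (\<Delta> + 1 / (2 * L) * (T * S + L\<^sup>2 * Q))"
    using \<Delta>_nonneg L_pos S Q(1) by (subst ennreal_mult'[symmetric]) (auto intro!: ennreal_plus[symmetric])
  finally have "?\<alpha> * Q \<le> \<Delta> + 1 / (2 * L) * (T * S + L\<^sup>2 * Q)"
    using \<Delta>_nonneg L_pos S Q(1) by (subst (asm) ennreal_le_iff) auto
  moreover have "1 / (2 * L) * (T * S + L\<^sup>2 * Q) = T * S / (2 * L) + L / 2 * Q"
    using L_pos by (simp add: field_simps power2_eq_square)
  ultimately have "\<theta> * Q \<le> \<Delta> + T * S / (2 * L)"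
    unfolding \<alpha>(1) by (simp add: distrib_right)
  then have "Q \<le> (\<Delta> + T * S / (2 * L)) / \<theta>"
    using \<theta> by (simp add: pos_le_divide_eq mult.commute)
  moreover have "0 \<le> \<gamma>"
    using L_pos \<eta>_pos by (simp add: \<gamma>_def)
  ultimately have "\<gamma> * Q \<le> \<gamma> * ((\<Delta> + T * S / (2 * L)) / \<theta>)"
    by (intro mult_left_mono)
  then have \<gamma>Q: "\<gamma> * Q \<le> \<gamma> / \<theta> * (\<Delta> + T * S / (2 * L))"
    by simp
  have "(\<Sum>t<T. second_moment (subgrad t)) = (\<integral>\<^sup>+\<omega>. ennreal (\<Sum>t<T. (norm (subgrad t \<omega>))\<^sup>2) \<partial>M)"
    unfolding second_moment_def by (subst nn_integral_sum[symmetric]) auto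
  also have "\<dots> \<le> (\<integral>\<^sup>+\<omega>. ennreal (2 / \<eta> * \<Delta> + ?c * (\<Sum>t<T. (norm (step t \<omega>))\<^sup>2) + 2 * (\<Sum>t<T. (norm (err t \<omega>))\<^sup>2)) \<partial>M)"
  proof (intro nn_integral_mono ennreal_leI)
    fix \<omega> assume "\<omega> \<in> space M"
    moreover from this have "2 / \<eta> * (\<Phi> x0 - \<Phi> (X T \<omega>)) \<le> 2 / \<eta> * \<Delta>"
      using \<eta>_pos by (intro mult_left_mono bounded r_X_finite) auto
    ultimately show "(\<Sum>t<T. (norm (subgrad t \<omega>))\<^sup>2) \<le> 2 / \<eta> * \<Delta> + ?c * (\<Sum>t<T. (norm (step t \<omega>))\<^sup>2) + 2 * (\<Sum>t<T. (norm (err t \<omega>))\<^sup>2)"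
      using sum_subgrad_le[of \<omega> T] by simp
  qed
  also have "\<dots> = ennreal (2 / \<eta> * \<Delta>) + ennreal ?c * ennreal Q + ennreal 2 * (\<Sum>t<T. second_moment (err t))"
    using \<eta>_pos \<Delta>_nonneg c by (subst nn_integral_affine) (auto simp: Q)
  also have "\<dots> \<le> ennreal (2 / \<eta> * \<Delta>) + ennreal ?c * ennreal Q + ennreal 2 * ennreal (T * S + L\<^sup>2 * Q)"
    using err by (intro add_left_mono mult_left_mono) auto
  also have "\<dots> = ennreal (2 / \<eta> * \<Delta> + ?c * Q + 2 * (T * S + L\<^sup>2 * Q))"
    using \<eta>_pos \<Delta>_nonneg c S Q(1) by (simp only: ennreal_mult[symmetric] ennreal_plus[symmetric] mult_nonneg_nonneg add_nonneg_nonneg divide_nonneg_nonneg zero_le_power2 zero_le_numeral less_imp_le)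
  also have "\<dots> \<le> ennreal (2 / \<eta> * \<Delta> + \<gamma> / \<theta> * (\<Delta> + T * S / (2 * L)) + 2 * (T * S))"
  proof (rule ennreal_leI)
    \<comment> \<open>The errors contribute \<open>2 * L\<^sup>2\<close>, which raises the leading
      \<open>2 * L\<^sup>2\<close> of \<open>?c\<close> to the \<open>4 * L\<^sup>2\<close> of
      \<open>\<gamma>\<close>.\<close>
    have "?c * Q + 2 * (L\<^sup>2 * Q) = \<gamma> * Q"
      by (simp add: \<gamma>_def algebra_simps)
    then show "2 / \<eta> * \<Delta> + ?c * Q + 2 * (T * S + L\<^sup>2 * Q) \<le> 2 / \<eta> * \<Delta> + \<gamma> / \<theta> * (\<Delta> + T * S / (2 * L)) + 2 * (T * S)"
      using \<gamma>Q unfolding distrib_left[of 2] by linarith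
  qed
  finally show ?thesis .
qed

text \<open>The distance at the output is dominated by \<open>subgrad (R - 1)\<close>, a function of
  the history and \<open>R\<close>. As these are independent, integrating over the uniform law of
  \<open>R\<close> turns the expectation into the average over all steps.\<close>

lemma expected_dist0_le:
  fixes F :: "'a \<Rightarrow> ereal" and R :: "'w \<Rightarrow> nat"
  defines "\<theta> \<equiv> (1 - 3 * \<eta> * L) / (2 * \<eta>)" and "\<gamma> \<equiv> 4 * L\<^sup>2 + 1 / \<eta>\<^sup>2 + 2 * L / \<eta>"
  assumes F: "F = (\<lambda>x. ereal (f x) + r x)" and "T \<ge> 1"
    and R: "uniform_output_index M D T b \<xi> X R"
  shows "(\<integral>\<^sup>+\<omega>. (dist0 (frechet_subdiff F (X (R \<omega>) \<omega>)))\<^sup>2 \<partial>M)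
           \<le> ennreal ((2 * \<theta> * \<Delta> + \<gamma> * \<eta> * \<Delta>) / (\<eta> * \<theta> * real T) + (\<gamma> + 4 * \<theta> * L) * S / (2 * \<theta> * L))"
proof -
  let ?H = "history b \<xi> X T" and ?N = "history_space b D T"
  have indep: "indep_rv M ?N ?H (count_space {1..T}) R"
    and distr: "distr M (count_space {1..T}) R = uniform_count_measure {1..T}"
    and R_meas: "R \<in> M \<rightarrow>\<^sub>M count_space {1..T}"
    using R unfolding uniform_output_index_def by auto
  have "\<forall>t<T. \<exists>g\<in>borel_measurable ?N. \<forall>\<omega>\<in>space M. subgrad t \<omega> = g (?H \<omega>)"
    using hist_fun_subgrad unfolding hist_fun_def by blast
  then obtain g where g_meas: "\<And>t. t < T \<Longrightarrow> g t \<in> borel_measurable ?N"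
    and g: "\<And>t \<omega>. t < T \<Longrightarrow> \<omega> \<in> space M \<Longrightarrow> subgrad t \<omega> = g t (?H \<omega>)"
    by metis
  \<comment> \<open>The second component ranges over \<open>{1..T}\<close>, so the subtraction is
    never truncated.\<close>
  define k where "k p = ennreal ((norm (g (snd p - 1) (fst p)))\<^sup>2)" for p
  have k_meas: "k \<in> borel_measurable (?N \<Otimes>\<^sub>M count_space {1..T})"
    unfolding k_def
  proof (rule measurable_compose_countable'[where f = "\<lambda>i p. ennreal ((norm (g (i - 1) (fst p)))\<^sup>2)" and I = "{1..T}"])
    fix i assume "i \<in> {1..T}"
    then have [measurable]: "g (i - 1) \<in> borel_measurable ?N"
      by (intro g_meas) auto
    show "(\<lambda>p. ennreal ((norm (g (i - 1) (fst p)))\<^sup>2)) \<in> borel_measurable (?N \<Otimes>\<^sub>M count_space {1..T})"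
      by measurable
  qed auto
  \<comment> \<open>No measurability of the distance has been shown; \<open>nn_integral\<close> is
    monotone regardless, and the dominating \<open>k\<close> is measurable.\<close>
  have "(\<integral>\<^sup>+\<omega>. (dist0 (frechet_subdiff F (X (R \<omega>) \<omega>)))\<^sup>2 \<partial>M) \<le> (\<integral>\<^sup>+\<omega>. k (?H \<omega>, R \<omega>) \<partial>M)"
  proof (rule nn_integral_mono)
    fix \<omega> assume \<omega>: "\<omega> \<in> space M"
    then have "R \<omega> \<in> {1..T}"
      using measurable_space[OF R_meas] by simp
    then obtain t where t: "R \<omega> = Suc t" "t < T"
      by (cases "R \<omega>") auto
    have "subgrad t \<omega> \<in> frechet_subdiff F (X (Suc t) \<omega>)"
      unfolding subgrad_def F using r(1) \<eta>_pos Lf X_Suc[OF \<omega> t(2)] by (rule prox_subgradient)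
    then show "(dist0 (frechet_subdiff F (X (R \<omega>) \<omega>)))\<^sup>2 \<le> k (?H \<omega>, R \<omega>)"
      using g[OF t(2) \<omega>] by (simp add: k_def t dist0_power2_le)
  qed
  also have "\<dots> = (\<integral>\<^sup>+\<omega>. \<integral>\<^sup>+i. k (?H \<omega>, i) \<partial>uniform_count_measure {1..T} \<partial>M)"
    using indep_rv_nn_integral[OF indep k_meas] unfolding distr .
  also have "\<dots> = (\<integral>\<^sup>+\<omega>. ennreal (1 / T) * (\<Sum>t<T. ennreal ((norm (subgrad t \<omega>))\<^sup>2)) \<partial>M)"
  proof (rule nn_integral_cong)
    fix \<omega> assume \<omega>: "\<omega> \<in> space M"
    have "(\<integral>\<^sup>+i. k (?H \<omega>, i) \<partial>uniform_count_measure {1..T}) = (\<Sum>i\<in>{1..T}. ennreal (1 / T) * k (?H \<omega>, i))"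
      unfolding uniform_count_measure_def by (simp add: nn_integral_point_measure_finite)
    also have "\<dots> = (\<Sum>t<T. ennreal (1 / T) * k (?H \<omega>, Suc t))"
      by (rule sum.reindex_bij_witness[of _ Suc "\<lambda>i. i - 1"]) auto
    also have "\<dots> = ennreal (1 / T) * (\<Sum>t<T. ennreal ((norm (subgrad t \<omega>))\<^sup>2))"
      unfolding sum_distrib_left using g[OF _ \<omega>] by (intro sum.cong) (auto simp: k_def)
    finally show "(\<integral>\<^sup>+i. k (?H \<omega>, i) \<partial>uniform_count_measure {1..T}) = ennreal (1 / T) * (\<Sum>t<T. ennreal ((norm (subgrad t \<omega>))\<^sup>2))" .
  qed
  also have "\<dots> = ennreal (1 / T) * (\<Sum>t<T. second_moment (subgrad t))"
    unfolding second_moment_def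
    by (subst nn_integral_cmult, measurable) (subst nn_integral_sum, auto)
  also have "\<dots> \<le> ennreal (1 / T) * ennreal (2 / \<eta> * \<Delta> + \<gamma> / \<theta> * (\<Delta> + T * S / (2 * L)) + 2 * (T * S))"
    unfolding \<theta>_def \<gamma>_def by (intro mult_left_mono expected_subgrad_le) simp
  also have "\<dots> = ennreal (1 / T * (2 / \<eta> * \<Delta> + \<gamma> / \<theta> * (\<Delta> + T * S / (2 * L)) + 2 * (T * S)))"
    by (rule ennreal_mult'[symmetric]) simp
  also have "1 / T * (2 / \<eta> * \<Delta> + \<gamma> / \<theta> * (\<Delta> + T * S / (2 * L)) + 2 * (T * S)) =
      (2 * \<theta> * \<Delta> + \<gamma> * \<eta> * \<Delta>) / (\<eta> * \<theta> * real T) + (\<gamma> + 4 * \<theta> * L) * S / (2 * \<theta> * L)"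
  proof -
    have "\<theta> > 0"
      using \<eta>L \<eta>_pos by (simp add: \<theta>_def)
    then show ?thesis
      using \<open>T \<ge> 1\<close> \<eta>_pos L_pos by (simp add: field_simps)
  qed
  finally show ?thesis .
qed

end

end

section \<open>The online and finite-sum settings as instances of the locale\<close>

theorem theorem3:
  fixes f :: "'a::euclidean_space \<Rightarrow> real"
    and r F :: "'a \<Rightarrow> ereal"
    and x0 xstar :: 'a
    and \<sigma> \<Delta> L c \<eta> \<gamma> \<theta> :: real
    and T q b1 b2 n :: nat
    and D :: "'s measure"
    and fs :: "'s \<Rightarrow> 'a \<Rightarrow> real"
    and M :: "'w measure"
    and \<xi> :: "nat \<Rightarrow> nat \<Rightarrow> 'w \<Rightarrow> 's"
    and G X :: "nat \<Rightarrow> 'w \<Rightarrow> 'a"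
    and R :: "'w \<Rightarrow> nat"
    and fi :: "nat \<Rightarrow> 'a \<Rightarrow> real"
    and M' :: "'v measure"
    and \<xi>' :: "nat \<Rightarrow> nat \<Rightarrow> 'v \<Rightarrow> nat"
    and G' X' :: "nat \<Rightarrow> 'v \<Rightarrow> 'a"
    and R' :: "'v \<Rightarrow> nat"
  assumes "proper r" and "lower_semicont r"
    and F_def: "F = (\<lambda>x. ereal (f x) + r x)"
    and "\<sigma> > 0" and "L > 0"
    and "is_arg_min F (\<lambda>_. True) xstar" and "F x0 - F xstar \<le> ereal \<Delta>"
    and "lipschitz_grad L f"
    and "0 < c" and "c < 1 / 3" and "\<eta> = c / L"
    and "\<forall>x. prox \<eta> r x \<noteq> {}"
    and "T \<ge> 1" and "b1 \<ge> 1" and "b2 \<ge> 1" and "q = b2"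
    and "\<gamma> = 4 * L\<^sup>2 + 1 / \<eta>\<^sup>2 + 2 * L / \<eta>"
    and "\<theta> = (1 - 3 * \<eta> * L) / (2 * \<eta>)"
  shows "\<gamma> > 0 \<and> \<theta> > 0 \<and>
    (stochastic_assms D fs f \<sigma> L \<and>
     spgr_online D fs r \<eta> T q b1 b2 x0 M \<xi> G X R \<longrightarrow>
       (\<integral>\<^sup>+\<omega>. (dist0 (frechet_subdiff F (X (R \<omega>) \<omega>)))\<^sup>2 \<partial>M)
         \<le> ennreal ((2 * \<theta> * \<Delta> + \<gamma> * \<eta> * \<Delta>) / (\<eta> * \<theta> * real T)
                    + (\<gamma> + 4 * \<theta> * L) * \<sigma>\<^sup>2 / (2 * \<theta> * L * real b1))) \<and>
    (n \<ge> 1 \<and> stochastic_assms (uniform_count_measure {1..n}) fi f \<sigma> L \<and>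
     spgr_finite_sum n fi f r \<eta> T q b2 x0 M' \<xi>' G' X' R' \<longrightarrow>
       (\<integral>\<^sup>+\<omega>. (dist0 (frechet_subdiff F (X' (R' \<omega>) \<omega>)))\<^sup>2 \<partial>M')
         \<le> ennreal ((2 * \<theta> * \<Delta> + \<gamma> * \<eta> * \<Delta>) / (\<eta> * \<theta> * real T)))"
proof -
  have "\<eta> > 0" and \<eta>L: "\<eta> * L = c"
    using assms by auto
  then have pos: "\<gamma> > 0" "\<theta> > 0"
    using assms by (auto intro!: add_pos_nonneg)
  obtain u where "r u \<noteq> \<infinity>"
    using \<open>proper r\<close> unfolding proper_def by blast
  moreover have F_min: "F xstar \<le> F x" for x
    using assms(6) unfolding is_arg_min_def by (auto simp: not_less)
  \<comment> \<open>Comparison with \<open>u\<close> makes the minimal value finite.\<close>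
  ultimately have r_xstar: "\<bar>r xstar\<bar> \<noteq> \<infinity>"
    using \<open>proper r\<close> F_min[of u] unfolding proper_def F_def by (cases "r u"; cases "r xstar") auto
  \<comment> \<open>Since \<open>F xstar\<close> is finite, an infinite \<open>r x0\<close> would
    make the initial gap infinite.\<close>
  have r_x0: "\<bar>r x0\<bar> \<noteq> \<infinity>"
    using \<open>proper r\<close> r_xstar assms(7) unfolding proper_def F_def by (cases "r x0"; cases "r xstar") auto
  have bounded: "(f x0 + real_of_ereal (r x0)) - (f x + real_of_ereal (r x)) \<le> \<Delta>" if "\<bar>r x\<bar> \<noteq> \<infinity>" for x
    using that r_x0 r_xstar F_min[of x] assms(7) unfolding F_def
    by (cases "r x0"; cases "r xstar"; cases "r x") auto
  have online: "(\<integral>\<^sup>+\<omega>. (dist0 (frechet_subdiff F (X (R \<omega>) \<omega>)))\<^sup>2 \<partial>M)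
      \<le> ennreal ((2 * \<theta> * \<Delta> + \<gamma> * \<eta> * \<Delta>) / (\<eta> * \<theta> * real T) + (\<gamma> + 4 * \<theta> * L) * \<sigma>\<^sup>2 / (2 * \<theta> * L * real b1))"
    if st: "stochastic_assms D fs f \<sigma> L" and run: "spgr_online D fs r \<eta> T q b1 b2 x0 M \<xi> G X R"
  proof -
    let ?b = "\<lambda>t. if q dvd t then b1 else b2"
    have R: "uniform_output_index M D T ?b \<xi> X R"
      using run unfolding spgr_online_def by (simp add: Let_def)
    have M: "prob_space M"
      using run unfolding spgr_online_def by (simp add: Let_def)
    \<comment> \<open>Averaging \<open>b1\<close> samples divides the variance bound by
      \<open>b1\<close>, whence this value of \<open>S\<close>.\<close>
    interpret spgr M D fs f r L \<eta> "\<sigma>\<^sup>2 / real b1" T q ?b "batch_grad fs b1" x0 \<xi> G X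
    proof (intro spgr.intro spgr_axioms.intro M)
      show "prob_space D" "unbiased_grad D fs f" "\<And>s. s \<in> space D \<Longrightarrow> lipschitz_grad L (fs s)"
        using st unfolding stochastic_assms_def stochastic_objective_def by auto
      show "spgr_run fs r \<eta> T q q (batch_grad fs b1) x0 M \<xi> G X" "fresh_batches M D T ?b \<xi> X"
        using run \<open>q = b2\<close> unfolding spgr_online_def by (simp_all add: Let_def)
      show "history ?b \<xi> X T \<in> M \<rightarrow>\<^sub>M history_space ?b D T"
        using R unfolding uniform_output_index_def indep_rv_def by blast
      show "batch_grad fs b1 = (\<lambda>_. grad f) \<and> \<sigma>\<^sup>2 / real b1 = 0 \<or>
        (\<exists>m \<sigma>'. m \<ge> 1 \<and> batch_grad fs b1 = batch_grad fs m \<and> (\<forall>t. q dvd t \<longrightarrow> ?b t = m) \<and>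
          bounded_grad_variance D fs f \<sigma>' \<and> \<sigma>\<^sup>2 / real b1 = \<sigma>'\<^sup>2 / real m)"
        using st \<open>b1 \<ge> 1\<close> unfolding stochastic_assms_def by (intro disjI2 exI[of _ b1] exI[of _ \<sigma>]) auto
    qed (use assms r_x0 \<eta>L \<open>\<eta> > 0\<close> in auto)
    show ?thesis
      using expected_dist0_le[OF _ F_def \<open>T \<ge> 1\<close> R, of \<Delta>] bounded
      unfolding \<Phi>_def assms(17,18)[symmetric] by (simp add: mult.commute[of "real b1"])
  qed
  have finite_sum: "(\<integral>\<^sup>+\<omega>. (dist0 (frechet_subdiff F (X' (R' \<omega>) \<omega>)))\<^sup>2 \<partial>M')
      \<le> ennreal ((2 * \<theta> * \<Delta> + \<gamma> * \<eta> * \<Delta>) / (\<eta> * \<theta> * real T))"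
    if st: "stochastic_assms (uniform_count_measure {1..n}) fi f \<sigma> L"
      and run: "spgr_finite_sum n fi f r \<eta> T q b2 x0 M' \<xi>' G' X' R'"
  proof -
    let ?b = "\<lambda>t. if q dvd t then 0 else b2" and ?D = "uniform_count_measure {1..n}"
    have R: "uniform_output_index M' ?D T ?b \<xi>' X' R'"
      using run unfolding spgr_finite_sum_def by (simp add: Let_def)
    have M: "prob_space M'"
      using run unfolding spgr_finite_sum_def by (simp add: Let_def)
    \<comment> \<open>Each epoch starts from the exact gradient, so \<open>S = 0\<close>. The batch
      size 0 at those times is admissible because the locale fixes the size to \<open>q\<close> only
      at the other times.\<close>
    interpret spgr M' ?D fi f r L \<eta> 0 T q ?b "\<lambda>_. grad f" x0 \<xi>' G' X'
    proof (intro spgr.intro spgr_axioms.intro M)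
      show "prob_space ?D" "unbiased_grad ?D fi f" "\<And>s. s \<in> space ?D \<Longrightarrow> lipschitz_grad L (fi s)"
        using st unfolding stochastic_assms_def stochastic_objective_def by auto
      show "spgr_run fi r \<eta> T q q (\<lambda>_. grad f) x0 M' \<xi>' G' X'" "fresh_batches M' ?D T ?b \<xi>' X'"
        using run \<open>q = b2\<close> unfolding spgr_finite_sum_def by (simp_all add: Let_def)
      show "history ?b \<xi>' X' T \<in> M' \<rightarrow>\<^sub>M history_space ?b ?D T"
        using R unfolding uniform_output_index_def indep_rv_def by blast
    qed (use assms r_x0 \<eta>L \<open>\<eta> > 0\<close> in auto)
    show ?thesis
      using expected_dist0_le[OF _ F_def \<open>T \<ge> 1\<close> R, of \<Delta>] bounded
      unfolding \<Phi>_def assms(17,18)[symmetric] by simp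
  qed
  show ?thesis
    using pos online finite_sum by blast
qed

end
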